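(* Let $G$ be a smooth real function on $(0,x_0)$, where $x_0=\sqrt[5]{\frac{-11+5\sqrt5}{2}}$, and let $m_G$ be defined implicitly by $$x=\pi\int_{\sqrt{m_G(x)}}^{+\infty}\eta(it/2)^4\,G\!\left(R(e^{-\pi t})\right)dt .$$ If $y\in(0,x_0)$ and $A$ satisfy $$5\int_0^{y}\frac{G(t)}{t\sqrt[6]{t^{-5}-11-t^5}}\,dt=A,$$ then $y=R\!\left(e^{-\pi\sqrt{m_G(A)}}\right)$.
   Context: $\eta(\tau)=e^{\pi i\tau/12}\prod_{n\ge1}(1-e^{2\pi i n\tau})$ is the Dedekind eta function ($\operatorname{Im}\tau>0$). For $0<q<1$, $R(q)=\cfrac{q^{1/5}}{1+\cfrac{q}{1+\cfrac{q^2}{1+\cdots}}}$ is the Rogers–Ramanujan continued fraction; it maps $(0,1)$ increasingly onto $(0,x_0)$. The function $m_G$ is the inverse of $r\mapsto m_G^{(-1)}(r):=\pi\int_{\sqrt r}^{\infty}\eta(it/2)^4G(R(e^{-\pi t}))\,dt$, $r>0$. *)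

theory Defs
  imports "HOL-Analysis.Analysis"
begin

definition dedekind_eta :: "complex \<Rightarrow> complex" where
  "dedekind_eta \<tau> = exp (pi * \<i> * \<tau> / 12) *
     (\<Prod>n. (1 - exp (2 * pi * \<i> * of_nat (Suc n) * \<tau>)))"

text \<open>Finite truncations of the tails of the Rogers--Ramanujan continued fraction.
  rr_tail q n k is the depth-n truncation of
  T_k = 1 + q^(k+1) / (1 + q^(k+2) / (1 + ...)), truncated with the value 1.\<close>
fun rr_tail :: "real \<Rightarrow> nat \<Rightarrow> nat \<Rightarrow> real" where
  "rr_tail q 0 k = 1"
| "rr_tail q (Suc n) k = 1 + q ^ (k + 1) / rr_tail q n (k + 1)"

definition RR :: "real \<Rightarrow> real" where
  "RR q = q powr (1/5) / lim (\<lambda>n. rr_tail q n 0)"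

definition x0 :: real where
  "x0 = root 5 ((-11 + 5 * sqrt 5) / 2)"

definition mG_inv :: "(real \<Rightarrow> real) \<Rightarrow> real \<Rightarrow> real" where
  "mG_inv G r = pi * integral {sqrt r..}
      (\<lambda>t. Re (dedekind_eta (\<i> * complex_of_real t / 2) ^ 4) * G (RR (exp (- pi * t))))"

definition mG :: "(real \<Rightarrow> real) \<Rightarrow> real \<Rightarrow> real" where
  "mG G = inv_into {0<..} (mG_inv G)"

definition smooth_on_real :: "real set \<Rightarrow> (real \<Rightarrow> real) \<Rightarrow> bool" where
  "smooth_on_real S f \<longleftrightarrow> (\<forall>n. \<forall>x\<in>S. ((deriv ^^ n) f) differentiable (at x))"

end

(*
Write p = q^5 and A = (q;p)(q^4;p), B = (q^2;p)(q^3;p), C = (p;p) for the infinite products. The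
Rogers--Ramanujan identities (Hardy and Wright's recursion in the exponent together with the Jacobi
triple product) give X := R(q)^5 = q (A/B)^5.

Bilateral Lambert series in the nome p, evaluated at q and q^2, satisfy quadratic relations because
their Laurent coefficients 1/(1 - p^n) obey a partial fraction identity. With D = q d/dq these relations show
that two linear combinations s1, s2 of the weight-one series have the same logarithmic derivatives as
B^2 C^2/A^3 and -q A^2 C^2/B^3; comparing at q = 0 they are equal to these products. Moreover
D log X = s1^2 + 11 s1 s2 - s2^2 and, with h = (A B)^6/q, D log h = -(s1^2 + s2^2). As s1^2 = S/X,
s2^2 = S X and s1 s2 = -S for S = q C^4/(A B), the quotient of 1/X - 11 - X by h is constant, so
1/X - 11 - X = h and D log X = S h.

Since S h = eta^4 h^(1/6), the substitution x = R(exp(-pi t)) turns one integral into the other on compact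
intervals, and the endpoints tend to 0 and infinity. The product h tends to 0 as q tends to 1, so R maps
onto (0, x0).
*)

theory Submission
  imports Defs
begin

subsection \<open>The continued fraction as a quotient of solutions of a recurrence\<close>

text \<open>The identities are modular in nature, but the proof stays on real q in (0,1) and uses no
  transformation law. What replaces it: among the points generated by q in the multiplicative group
  modulo p = q^5, only q and q^2 are nontrivial up to inversion. The addition relations at (q, q)
  and (q, q^2) lead to q^2 and q^3 = p / q^2, so they close up into a differential system in
  finitely many unknowns, and each product formula becomes a polynomial identity plus a limit at 0.
  Along x = q^a, p = q^5 the derivation q d/dq is a x d/dx + 5 p d/dp; this is why each series is
  accompanied by its derivative in either variable.

  The number \<open>x0 ^ 5\<close> is the positive zero of 1/X - 11 - X, and the sixth root in the
  integrand is h^(1/6).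

  G may change sign and the integrals are gauge integrals that may converge only conditionally, so
  the endpoints are reached by continuity of the integral, not by domination.\<close>

lemma rr_tail_ge_1:
  assumes "0 < q"
  shows "rr_tail q n k \<ge> 1"
proof (induction n arbitrary: k)
  case (Suc n)
  have "0 < rr_tail q n (k+1)" using Suc[of "k+1"] by linarith
  then show ?case using assms by simp
qed simp

text \<open>The quotients \<open>F k / F (Suc k)\<close> obey the recursion of the infinite tails.
  One level of the fraction multiplies the truncation error by \<open>q ^ Suc k\<close> and divides
  it by a product of two numbers that are at least 1, so the error after n levels is at most
  \<open>q ^ n\<close>.\<close>

lemma rr_tail_tendsto:
  assumes q: "0 < q" "q < 1" and pos: "\<And>k. F k > 0"
    and rec: "\<And>k. F k = F (Suc k) + q ^ Suc k * F (Suc (Suc k))"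
  shows "(\<lambda>n. rr_tail q n 0) \<longlonglongrightarrow> F 0 / F 1"
proof -
  define T where "T k = F k / F (Suc k)" for k
  have T_rec: "T k = 1 + q ^ Suc k / T (Suc k)" for k
    using pos[of "Suc k"] pos[of "Suc (Suc k)"] rec[of k] by (simp add: T_def field_simps)
  have T_pos: "0 < T k" for k using pos by (simp add: T_def)
  have T_ge: "T k \<ge> 1" for k using T_rec[of k] T_pos[of "Suc k"] q by simp
  have err: "\<bar>rr_tail q n k - T k\<bar> \<le> q ^ n" for n k
  proof (induction n arbitrary: k)
    case 0
    have "q ^ Suc k / T (Suc k) \<le> 1 / 1"
      by (rule frac_le) (use q T_ge power_le_one[of q "Suc k"] in auto)
    moreover have "0 \<le> q ^ Suc k / T (Suc k)" using T_pos[of "Suc k"] q by simp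
    ultimately show ?case using T_rec[of k] by simp
  next
    case (Suc n)
    let ?r = "rr_tail q n (Suc k)" and ?t = "T (Suc k)"
    have r: "?r \<ge> 1" and t: "?t \<ge> 1" using rr_tail_ge_1 q T_ge by auto
    have "rr_tail q (Suc n) k - T k = q ^ Suc k * (?t - ?r) / (?r * ?t)"
      using r t by (simp add: T_rec[of k] field_simps)
    also have "\<bar>\<dots>\<bar> = q ^ Suc k * \<bar>?r - ?t\<bar> / (?r * ?t)"
      using q r t by (simp add: abs_mult abs_minus_commute)
    also have "\<dots> \<le> q ^ 1 * q ^ n / 1"
    proof (intro frac_le mult_mono Suc)
      show "q ^ Suc k \<le> q ^ 1" by (rule power_decreasing) (use q in auto)
      show "1 \<le> ?r * ?t" using mult_mono[of 1 ?r 1 ?t] r t by simp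
    qed (use q in auto)
    finally show ?case by simp
  qed
  have "(\<lambda>n. rr_tail q n 0 - T 0) \<longlonglongrightarrow> 0"
    by (rule Lim_null_comparison[OF _ LIMSEQ_realpow_zero[of q]]) (use q err in auto)
  from tendsto_add[OF this tendsto_const[of "T 0"]] show ?thesis
    by (simp add: T_def)
qed

section \<open>Finite and infinite q-products\<close>

definition qpoch :: "real \<Rightarrow> nat \<Rightarrow> real" where
  "qpoch q n = (\<Prod>k<n. 1 - q ^ Suc k)"

lemma qpoch_0 [simp]: "qpoch q 0 = 1"
  and qpoch_Suc: "qpoch q (Suc n) = qpoch q n * (1 - q ^ Suc n)"
  by (simp_all add: qpoch_def)

lemma qpoch_pos:
  assumes "0 < q" "q < 1"
  shows "0 < qpoch q n"
  unfolding qpoch_def by (rule prod_pos) (use assms power_Suc_less_one[of q] in auto)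

text \<open>In Pochhammer notation, (q^a; q^m) with infinitely many factors. The modulus m = 5
  splits (q; q) by residue classes into the factors of A, B and C.\<close>

definition qpoch_inf :: "real \<Rightarrow> nat \<Rightarrow> nat \<Rightarrow> real" where
  "qpoch_inf q m a = (\<Prod>k. 1 - q ^ (m * k + a))"

lemma summable_power_arith:
  fixes q :: real
  assumes "0 < q" "q < 1" "0 < m"
  shows "summable (\<lambda>k. q ^ (m * k + a))"
proof -
  have "summable (\<lambda>k. q ^ a * (q ^ m) ^ k)"
    by (intro summable_mult summable_geometric) (use assms power_less_one_iff[of q m] in auto)
  then show ?thesis by (simp add: power_add mult.commute flip: power_mult)
qed

lemma qpoch_inf_has_prod:
  assumes "0 < q" "q < 1" "0 < m" "0 < a"
  shows "(\<lambda>k. 1 - q ^ (m * k + a)) has_prod qpoch_inf q m a"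
proof -
  have "q ^ (m * k + a) < 1" for k using assms power_less_one_iff[of q] by simp
  then have ne: "q ^ (m * k + a) \<noteq> 1" for k by (metis less_irrefl)
  have "convergent_prod (\<lambda>k. 1 + (- (q ^ (m * k + a))))"
    by (rule summable_imp_convergent_prod_real)
      (use assms summable_power_arith[OF assms(1-3)] ne in \<open>auto simp: power_abs\<close>)
  then show ?thesis unfolding qpoch_inf_def by (simp add: convergent_prod_has_prod)
qed

lemma qpoch_inf_pos:
  assumes "0 < q" "q < 1" "0 < m" "0 < a"
  shows "0 < qpoch_inf q m a"
  unfolding qpoch_inf_def
  by (rule less_0_prodinf)
    (use assms qpoch_inf_has_prod[OF assms] power_less_one_iff[of q] in \<open>auto simp: has_prod_iff\<close>)

lemma qpoch_inf_LIMSEQ: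
  assumes "0 < q" "q < 1" "0 < m" "0 < a"
  shows "(\<lambda>n. \<Prod>k<n. 1 - q ^ (m * k + a)) \<longlonglongrightarrow> qpoch_inf q m a"
  using has_prod_imp_tendsto'[OF qpoch_inf_has_prod[OF assms]] .

lemma qpoch_LIMSEQ:
  assumes "0 < q" "q < 1"
  shows "qpoch q \<longlonglongrightarrow> qpoch_inf q 1 1"
  using qpoch_inf_LIMSEQ[of q 1 1] assms by (simp add: qpoch_def [abs_def])

lemma qpoch_ge:
  assumes "0 < q" "q < 1"
  shows "qpoch_inf q 1 1 \<le> qpoch q n"
proof (rule decseq_ge[OF _ qpoch_LIMSEQ[OF assms]])
  show "decseq (qpoch q)"
  proof (rule decseq_SucI)
    fix n
    have "qpoch q n * (1 - q ^ Suc n) \<le> qpoch q n * 1"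
      by (rule mult_left_mono) (use assms qpoch_pos[OF assms, of n] in auto)
    then show "qpoch q (Suc n) \<le> qpoch q n" by (simp add: qpoch_Suc)
  qed
qed

lemma qpoch_le_1:
  assumes "0 < q" "q < 1"
  shows "qpoch q n \<le> 1"
  unfolding qpoch_def by (rule prod_le_1) (use assms power_Suc_less_one[of q] in \<open>auto simp: less_imp_le\<close>)

subsection \<open>The Jacobi triple product\<close>

text \<open>The factor \<open>1 + w * p ^ N\<close> that enters in the induction step yields the
  q-Pascal rule for the coefficients. The triangular exponents are real numbers, so recentring the
  sum later needs no truncated subtraction or halving.\<close>

lemma q_binomial:
  fixes w :: real
  assumes p: "0 < p" "p < 1"
  shows "(\<Prod>k<N. 1 + w * p ^ k) =
    (\<Sum>i\<le>N. qpoch p N / (qpoch p i * qpoch p (N - i)) * p powr (real i * (real i - 1) / 2) * w ^ i)"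
proof (induction N)
  case 0
  then show ?case using p by simp
next
  case (Suc N)
  define c where "c N i = qpoch p N / (qpoch p i * qpoch p (N - i)) * p powr (real i * (real i - 1) / 2)" for N i
  have nz: "qpoch p n \<noteq> 0" for n using qpoch_pos[OF p, of n] by simp
  have pw: "p ^ n = p powr real n" for n using p by (simp add: powr_realpow)
  have c0: "c N 0 = 1" for N using nz p by (simp add: c_def)
  have c_top: "c (Suc N) (Suc N) = c N N * p ^ N"
    using nz by (simp add: c_def pw flip: powr_add) (simp add: field_simps)
  have c_mid: "c (Suc N) (Suc i) = c N (Suc i) + c N i * p ^ N" if "i < N" for i
  proof -
    obtain d where d: "N = Suc i + d" using \<open>i < N\<close> less_iff_Suc_add by auto
    have e: "p powr (real (Suc i) * (real (Suc i) - 1) / 2) = p ^ i * p powr (real i * (real i - 1) / 2)"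
      by (simp add: pw flip: powr_add) (simp add: field_simps)
    \<comment> \<open>\<open>K\<close> is the common part of the three q-binomials. What is left of
      the q-Pascal rule is p^i (1 - p^(N+1)) = p^i (1 - p^(d+1)) + p^N (1 - p^(i+1)), true because N
      = i + 1 + d.\<close>
    define K where "K = qpoch p N / (qpoch p (Suc i) * qpoch p (Suc d))"
    have nz1: "1 - p ^ Suc n \<noteq> 0" for n using power_Suc_less_one[OF p, of n] by simp
    have K1: "qpoch p (Suc N) / (qpoch p (Suc i) * qpoch p (Suc N - Suc i)) = K * (1 - p ^ Suc N)"
      by (simp add: K_def d qpoch_Suc[of p "Suc (i + d)"] del: power_Suc)
    have K2: "qpoch p N / (qpoch p (Suc i) * qpoch p (N - Suc i)) = K * (1 - p ^ Suc d)"
      using d nz nz1[of d] by (simp add: K_def qpoch_Suc[of p d] del: power_Suc)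
    have K3: "qpoch p N / (qpoch p i * qpoch p (N - i)) = K * (1 - p ^ Suc i)"
      using d nz nz1[of i] by (simp add: K_def qpoch_Suc[of p i] Suc_diff_le del: power_Suc)
    show ?thesis
      unfolding c_def e K1 K2 K3 by (simp add: d power_add algebra_simps)
  qed
  have "(\<Prod>k<Suc N. 1 + w * p ^ k) = (\<Sum>i\<le>N. c N i * w ^ i) * (1 + w * p ^ N)"
    using Suc by (simp add: c_def)
  also have "\<dots> = (\<Sum>i\<le>N. c N i * w ^ i) + (\<Sum>i\<le>N. c N i * p ^ N * w ^ Suc i)"
    by (simp add: algebra_simps sum_distrib_left sum.distrib)
  also have "(\<Sum>i\<le>N. c N i * w ^ i) = 1 + (\<Sum>i<N. c N (Suc i) * w ^ Suc i)"
    using sum.atMost_shift[of "\<lambda>i. c N i * w ^ i" N] by (simp add: c0)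
  also have "(\<Sum>i\<le>N. c N i * p ^ N * w ^ Suc i) =
      (\<Sum>i<N. c N i * p ^ N * w ^ Suc i) + c (Suc N) (Suc N) * w ^ Suc N"
    by (simp add: c_top sum.lessThan_Suc flip: lessThan_Suc_atMost)
  also have "1 + (\<Sum>i<N. c N (Suc i) * w ^ Suc i) + \<dots> =
      1 + (\<Sum>i<N. c (Suc N) (Suc i) * w ^ Suc i) + c (Suc N) (Suc N) * w ^ Suc N"
    by (simp add: c_mid sum.distrib algebra_simps)
  also have "\<dots> = (\<Sum>i\<le>Suc N. c (Suc N) i * w ^ i)"
    using sum.atMost_shift[of "\<lambda>i. c (Suc N) i * w ^ i" "Suc N"] by (simp add: c0 sum.lessThan_Suc)
  finally show ?case by (simp add: c_def)
qed

lemma prod_lessThan_add: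
  fixes f :: "nat \<Rightarrow> 'a::comm_monoid_mult"
  shows "(\<Prod>k<m + n. f k) = (\<Prod>k<m. f k) * (\<Prod>k<n. f (m + k))"
  by (induction n) (simp_all add: mult.assoc)

text \<open>The q-binomial theorem with 2 n factors and w = -z / p^n. The last n factors are 1 - z
  p^k; the first n, in reverse order, are (1 - p^(k+1) / z) times -z / p^(k+1). These monomials are
  collected in \<open>P\<close> and divided out after the sum has been split at its middle index
  n.\<close>

lemma jacobi_triple_product_finite:
  fixes z :: real
  assumes p: "0 < p" "p < 1" and z: "0 < z"
  defines "c n r \<equiv> qpoch p (2 * n) / (qpoch p (n + r) * qpoch p (n - r))"
  shows "(\<Prod>k<n. (1 - z * p ^ k) * (1 - p ^ Suc k / z)) =
    (\<Sum>r\<le>n. c n r * ((-1) ^ r * p powr (real r * (real r - 1) / 2) * z ^ r)) +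
    (\<Sum>r<n. c n (Suc r) * ((-1) ^ Suc r * p powr (real (Suc r) * (real (Suc r) + 1) / 2) / z ^ Suc r))"
proof -
  have pw: "p ^ m = p powr real m" for m using p by (simp add: powr_realpow)
  have power_quotient: "(- z / p ^ n) ^ d = (-1) ^ d * z ^ d * p powr (- (real n * real d))" for d
  proof -
    have "(- z / p ^ n) ^ d = (- z) ^ d / p ^ (n * d)" by (simp only: power_divide power_mult)
    also have "p ^ (n * d) = p powr (real n * real d)" using pw[of "n * d"] by simp
    also have "(- z) ^ d = (-1) ^ d * z ^ d" by (rule power_minus)
    finally show ?thesis by (simp add: powr_minus_divide)
  qed
  define P where "P = (\<Prod>k<n. - z / p ^ Suc k)"
  have P_eq: "P = (-1) ^ n * z ^ n * p powr (- (real n * (real n + 1) / 2))"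
    unfolding P_def
  proof (induction n)
    case (Suc n)
    have "- z / p ^ Suc n = - z * p powr (- real (Suc n))"
      unfolding pw by (simp only: powr_minus_divide times_divide_eq_right mult_1_right)
    moreover have "p powr (- (real n * (real n + 1) / 2)) * p powr (- real (Suc n)) =
        p powr (- (real (Suc n) * (real (Suc n) + 1) / 2))"
      unfolding powr_add [symmetric] by (rule arg_cong) (simp add: field_simps)
    ultimately show ?case
      using Suc by (simp del: of_nat_Suc power_Suc) (simp add: mult_ac)
  qed (use p in simp)
  have P_nz: "P \<noteq> 0" using p z by (simp add: P_def)
  define f where "f i = qpoch p (2 * n) / (qpoch p i * qpoch p (2 * n - i)) *
    p powr (real i * (real i - 1) / 2) * (- z / p ^ n) ^ i" for i
  have "(\<Prod>k<2 * n. 1 + (- z / p ^ n) * p ^ k) =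
      (\<Prod>k<n. 1 + (- z / p ^ n) * p ^ k) * (\<Prod>k<n. 1 + (- z / p ^ n) * p ^ (n + k))"
    unfolding mult_2 by (rule prod_lessThan_add)
  also have "(\<Prod>k<n. 1 + (- z / p ^ n) * p ^ k) = (\<Prod>k<n. 1 + (- z / p ^ n) * p ^ (n - Suc k))"
    by (rule prod.nat_diff_reindex [symmetric])
  also have "\<dots> = (\<Prod>k<n. (1 - p ^ Suc k / z) * (- z / p ^ Suc k))"
  proof (rule prod.cong[OF refl])
    fix k assume "k \<in> {..<n}"
    then obtain d where "n = Suc k + d" using less_iff_Suc_add by auto
    then show "1 + (- z / p ^ n) * p ^ (n - Suc k) = (1 - p ^ Suc k / z) * (- z / p ^ Suc k)"
      using p z by (simp add: power_add field_simps)
  qed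
  also have "\<dots> = (\<Prod>k<n. 1 - p ^ Suc k / z) * P"
    unfolding P_def by (rule prod.distrib)
  also have "(\<Prod>k<n. 1 + (- z / p ^ n) * p ^ (n + k)) = (\<Prod>k<n. 1 - z * p ^ k)"
    using p by (simp add: power_add)
  finally have "(\<Prod>k<n. (1 - z * p ^ k) * (1 - p ^ Suc k / z)) * P = (\<Sum>i\<le>2 * n. f i)"
    unfolding q_binomial[OF p] f_def by (simp add: prod.distrib mult_ac)
  also have "(\<Sum>i\<le>2 * n. f i) = (\<Sum>i<n. f i) + (\<Sum>i=n..2*n. f i)"
    by (subst sum.union_disjoint [symmetric]) (auto intro!: sum.cong)
  also have "(\<Sum>i<n. f i) = (\<Sum>r<n. f (n - Suc r))"
    by (rule sum.nat_diff_reindex [symmetric])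
  also have "(\<Sum>i=n..2*n. f i) = (\<Sum>r\<le>n. f (n + r))"
    using sum.shift_bounds_cl_nat_ivl[of f 0 n n] by (simp add: atLeast0AtMost mult_2 add.commute)
  also have "(\<Sum>r\<le>n. f (n + r)) = (\<Sum>r\<le>n. c n r * ((-1) ^ r * p powr (real r * (real r - 1) / 2) * z ^ r)) * P"
    unfolding sum_distrib_right
  proof (rule sum.cong[OF refl])
    fix r
    have "(- z / p ^ n) ^ (n + r) = (-1) ^ n * (-1) ^ r * z ^ n * z ^ r * p powr (- (real n * real (n + r)))"
      unfolding power_quotient by (simp add: power_add)
    then have "f (n + r) = c n r * ((-1) ^ n * (-1) ^ r * z ^ n * z ^ r) *
        (p powr (real (n + r) * (real (n + r) - 1) / 2) * p powr (- (real n * real (n + r))))"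
      unfolding f_def c_def by (simp add: mult_ac mult_2)
    also have "p powr (real (n + r) * (real (n + r) - 1) / 2) * p powr (- (real n * real (n + r))) =
        p powr (real r * (real r - 1) / 2) * p powr (- (real n * (real n + 1) / 2))"
      unfolding powr_add [symmetric] by (rule arg_cong) (simp add: field_simps)
    finally show "f (n + r) = c n r * ((-1) ^ r * p powr (real r * (real r - 1) / 2) * z ^ r) * P"
      unfolding P_eq by (simp only: mult_ac)
  qed
  also have "(\<Sum>r<n. f (n - Suc r)) = (\<Sum>r<n. c n (Suc r) * ((-1) ^ Suc r * p powr (real (Suc r) * (real (Suc r) + 1) / 2) / z ^ Suc r)) * P"
    unfolding sum_distrib_right
  proof (rule sum.cong[OF refl])
    fix r assume "r \<in> {..<n}"
    then obtain d where d: "n = Suc r + d" using less_iff_Suc_add by auto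
    have "(- z / p ^ n) ^ d = (-1) ^ n * (-1) ^ Suc r * z ^ n / z ^ Suc r * p powr (- (real n * real d))"
      unfolding power_quotient unfolding d using z by (simp add: power_add)
    moreover have "n - Suc r = d" "2 * n - d = n + Suc r" using d by auto
    ultimately have "f (n - Suc r) = c n (Suc r) * ((-1) ^ n * (-1) ^ Suc r * z ^ n / z ^ Suc r) *
        (p powr (real d * (real d - 1) / 2) * p powr (- (real n * real d)))"
      unfolding f_def c_def by (simp add: mult_ac del: power_Suc of_nat_Suc)
    also have "p powr (real d * (real d - 1) / 2) * p powr (- (real n * real d)) =
        p powr (real (Suc r) * (real (Suc r) + 1) / 2) * p powr (- (real n * (real n + 1) / 2))"
      unfolding powr_add [symmetric] d by (rule arg_cong) (simp add: field_simps)
    finally show "f (n - Suc r) = c n (Suc r) * ((-1) ^ Suc r * p powr (real (Suc r) * (real (Suc r) + 1) / 2) / z ^ Suc r) * P"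
      unfolding P_eq by (simp only: mult_ac times_divide_eq_right times_divide_eq_left)
  qed
  finally show ?thesis using P_nz by (simp add: ring_distribs[symmetric] add.commute)
qed

text \<open>Dominated convergence for series: every coefficient tends to I / (I * I) and is bounded
  by 1 / (I * I), where I = (p; p). The offsets i and j let one statement serve both halves of the
  finite identity, whose ranges and indices differ by one.\<close>

lemma tannery_triple_product:
  assumes p: "0 < p" "p < 1" and g: "summable (\<lambda>r. \<bar>g r\<bar>)"
  defines "c n r \<equiv> qpoch p (2 * n) / (qpoch p (n + r) * qpoch p (n - r))"
  shows "(\<lambda>n. \<Sum>r<n + i. c n (r + j) * g r) \<longlonglongrightarrow> suminf g / qpoch_inf p 1 1"
proof -
  define I where "I = qpoch_inf p 1 1"
  have I_pos: "I > 0" using qpoch_inf_pos[OF p, of 1 1] by (simp add: I_def)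
  have lim: "(\<lambda>n. c n r) \<longlonglongrightarrow> 1 / I" for r
  proof -
    have l1: "(\<lambda>n. qpoch p (2 * n)) \<longlonglongrightarrow> I"
      unfolding I_def
      by (rule filterlim_compose[OF qpoch_LIMSEQ[OF p]]) (auto intro!: filterlim_subseq strict_monoI)
    have l2: "(\<lambda>n. qpoch p (n + r)) \<longlonglongrightarrow> I"
      unfolding I_def by (rule LIMSEQ_ignore_initial_segment[OF qpoch_LIMSEQ[OF p]])
    have l3: "(\<lambda>n. qpoch p (n - r)) \<longlonglongrightarrow> I"
      unfolding I_def by (rule filterlim_compose[OF qpoch_LIMSEQ[OF p] filterlim_minus_const_nat_at_top])
    have "(\<lambda>n. c n r) \<longlonglongrightarrow> I / (I * I)"
      unfolding c_def by (intro tendsto_intros l1 l2 l3) (use I_pos in auto)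
    then show ?thesis using I_pos by simp
  qed
  have c_bound: "\<bar>c n r\<bar> \<le> 1 / (I * I)" for n r
  proof -
    have "0 \<le> c n r" unfolding c_def by (simp add: qpoch_pos[OF p] less_imp_le)
    moreover have "c n r \<le> 1 / (I * I)"
      unfolding c_def
      by (intro frac_le mult_mono) (use I_pos qpoch_pos[OF p] qpoch_ge[OF p] qpoch_le_1[OF p] in \<open>auto simp: I_def less_imp_le\<close>)
    ultimately show ?thesis by simp
  qed
  define a where "a r n = (if r < n + i then c n (r + j) * g r else 0)" for r n
  have "((\<lambda>n. suminf (\<lambda>r. a r n)) \<longlongrightarrow> suminf (\<lambda>r. 1 / I * g r)) sequentially"
  proof (rule tannerys_theorem[where M = "\<lambda>r. 1 / (I * I) * \<bar>g r\<bar>", THEN conjunct2, THEN conjunct2])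
    show "((\<lambda>n. a r n) \<longlongrightarrow> 1 / I * g r) sequentially" for r
    proof (rule Lim_transform_eventually)
      show "(\<lambda>n. c n (r + j) * g r) \<longlonglongrightarrow> 1 / I * g r" by (intro tendsto_intros lim)
      show "\<forall>\<^sub>F n in sequentially. c n (r + j) * g r = a r n"
        using eventually_gt_at_top[of r] by eventually_elim (simp add: a_def)
    qed
    have "norm (a r n) \<le> 1 / (I * I) * \<bar>g r\<bar>" for r n
      using mult_right_mono[OF c_bound[of n "r + j"], of "\<bar>g r\<bar>"] by (simp add: a_def abs_mult)
    then show "\<forall>\<^sub>F (r, n) in at_top \<times>\<^sub>F sequentially. norm (a r n) \<le> 1 / (I * I) * \<bar>g r\<bar>"
      by (intro always_eventually) (simp only: split_beta, blast)
  qed (use g in \<open>auto intro: summable_mult\<close>)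
  moreover have "suminf (\<lambda>r. a r n) = (\<Sum>r<n + i. c n (r + j) * g r)" for n
    by (subst suminf_finite[of "{..<n + i}"]) (auto simp: a_def)
  moreover have "suminf (\<lambda>r. 1 / I * g r) = suminf g / I"
    using suminf_mult[OF summable_rabs_cancel[OF g], of "1 / I"] by simp
  ultimately show ?thesis by (simp add: I_def)
qed

text \<open>On p < z < 1 the two halves are dominated by geometric series in z and in p / z. For
  this the exponent of p need only be nonnegative in the first half and at least r + 1 in the
  second.\<close>

theorem jacobi_triple_product:
  assumes p: "0 < p" "p < 1" and z: "p < z" "z < 1"
  defines "g r \<equiv> (-1) ^ r * p powr (real r * (real r - 1) / 2) * z ^ r"
    and "h r \<equiv> (-1) ^ Suc r * p powr (real (Suc r) * (real (Suc r) + 1) / 2) / z ^ Suc r"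
  shows "(\<lambda>n. \<Prod>k<n. (1 - z * p ^ k) * (1 - p ^ Suc k / z)) \<longlonglongrightarrow> (\<Sum>r. g r + h r) / qpoch_inf p 1 1"
proof -
  have z_pos: "0 < z" using p z by linarith
  have g: "summable (\<lambda>r. \<bar>g r\<bar>)"
  proof (rule summable_comparison_test')
    show "summable (\<lambda>r. z ^ r)" using z z_pos by (intro summable_geometric) simp
    fix r :: nat
    have "0 \<le> real r * (real r - 1) / 2" by (cases r) auto
    then have "p powr (real r * (real r - 1) / 2) \<le> 1" using p by (intro powr_le1) auto
    then show "norm \<bar>g r\<bar> \<le> z ^ r"
      using z_pos by (simp add: g_def abs_mult mult_left_le_one_le)
  qed
  have h: "summable (\<lambda>r. \<bar>h r\<bar>)"
  proof (rule summable_comparison_test')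
    show "summable (\<lambda>r. (p / z) ^ Suc r)"
      unfolding summable_Suc_iff using z z_pos p by (intro summable_geometric) simp
    fix r :: nat
    have "p powr (real (Suc r) * (real (Suc r) + 1) / 2) \<le> p powr (real (Suc r))"
      by (rule powr_mono') (use p in \<open>auto simp: field_simps\<close>)
    then have "p powr (real (Suc r) * (real (Suc r) + 1) / 2) / z ^ Suc r \<le> p ^ Suc r / z ^ Suc r"
      using z_pos p by (intro divide_right_mono) (auto simp: powr_realpow simp del: of_nat_Suc power_Suc)
    then show "norm \<bar>h r\<bar> \<le> (p / z) ^ Suc r"
      using z_pos by (simp add: h_def abs_mult power_divide)
  qed
  have "(\<lambda>n. (\<Sum>r\<le>n. qpoch p (2 * n) / (qpoch p (n + r) * qpoch p (n - r)) * g r) +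
      (\<Sum>r<n. qpoch p (2 * n) / (qpoch p (n + Suc r) * qpoch p (n - Suc r)) * h r))
    \<longlonglongrightarrow> suminf g / qpoch_inf p 1 1 + suminf h / qpoch_inf p 1 1"
    using tendsto_add[OF tannery_triple_product[OF p g, where i = 1 and j = 0]
        tannery_triple_product[OF p h, where i = 0 and j = 1]]
    by (simp add: lessThan_Suc_atMost)
  then show ?thesis
    unfolding jacobi_triple_product_finite[OF p z_pos] g_def h_def
      suminf_add[OF summable_rabs_cancel[OF g] summable_rabs_cancel[OF h], unfolded g_def h_def, symmetric]
    by (simp add: add_divide_distrib)
qed

subsection \<open>The Rogers--Ramanujan identities\<close>

text \<open>The exponents r (5 r + 1) / 2, given through their increments so that they are natural
  numbers without a division.\<close>

fun lam :: "nat \<Rightarrow> nat" where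
  "lam 0 = 0"
| "lam (Suc r) = lam r + 5 * r + 3"

lemma real_lam: "real (lam r) = real r * (5 * real r + 1) / 2"
  by (induction r) (auto simp: field_simps)

lemma lam_ge: "r \<le> lam r"
  by (induction r) auto

text \<open>The series $(x)_\<infinity> H_2(x^{j+1})$ and $(x)_\<infinity> H_1(x^{j+1})$ of Hardy and Wright, Section 19.14.\<close>

definition F_term :: "real \<Rightarrow> nat \<Rightarrow> nat \<Rightarrow> real" where
  "F_term x j r = (-1) ^ r * x ^ (2 * j * r + lam r) * (1 - x ^ (2 * (j + 1 + 2 * r))) * (qpoch x (r + j) / qpoch x r)"

definition E_term :: "real \<Rightarrow> nat \<Rightarrow> nat \<Rightarrow> real" where
  "E_term x j r = (-1) ^ r * x ^ ((2 * j + 1) * r + lam r) * (1 - x ^ (j + 1 + 2 * r)) * (qpoch x (r + j) / qpoch x r)"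

context
  fixes x :: real
  assumes x: "0 < x" "x < 1"
begin

lemma qpoch_ratio_bound: "\<bar>qpoch x (r + j) / qpoch x r\<bar> \<le> 1 / qpoch_inf x 1 1"
proof -
  have "qpoch x (r + j) / qpoch x r \<le> 1 / qpoch_inf x 1 1"
    by (rule frac_le) (use qpoch_le_1[OF x] qpoch_ge[OF x] qpoch_inf_pos[OF x] in auto)
  moreover have "0 < qpoch x (r + j) / qpoch x r" using qpoch_pos[OF x] by simp
  ultimately show ?thesis by simp
qed

lemma telescoping_bound:
  assumes "m \<le> e" "\<bar>b\<bar> \<le> 1"
  shows "\<bar>(-1) ^ r * x ^ e * b * (qpoch x (s + j) / qpoch x s)\<bar> \<le> 1 / qpoch_inf x 1 1 * x ^ m"
proof -
  have "x ^ e \<le> x ^ m" by (rule power_decreasing) (use assms x in auto)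
  then have "x ^ e * \<bar>b\<bar> \<le> x ^ m * 1" by (intro mult_mono) (use x assms in auto)
  then have "(x ^ e * \<bar>b\<bar>) * \<bar>qpoch x (s + j) / qpoch x s\<bar> \<le> (x ^ m * 1) * (1 / qpoch_inf x 1 1)"
    by (rule mult_mono[OF _ qpoch_ratio_bound]) (use x in auto)
  then show ?thesis using x by (simp add: abs_mult mult_ac)
qed

lemma one_minus_power_bound: "\<bar>1 - x ^ n\<bar> \<le> 1"
  using x power_le_one[of x n] by simp

lemma F_term_bound: "\<bar>F_term x j r\<bar> \<le> 1 / qpoch_inf x 1 1 * x ^ r"
  unfolding F_term_def by (rule telescoping_bound[OF trans_le_add2[OF lam_ge] one_minus_power_bound])

lemma E_term_bound: "\<bar>E_term x j r\<bar> \<le> 1 / qpoch_inf x 1 1 * x ^ r"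
  unfolding E_term_def by (rule telescoping_bound[OF trans_le_add2[OF lam_ge] one_minus_power_bound])

lemma summable_bound: "summable (\<lambda>r. 1 / qpoch_inf x 1 1 * x ^ r)"
  by (intro summable_mult summable_geometric) (use x in auto)

lemma summable_F_term: "summable (F_term x j)"
  by (rule summable_comparison_test'[OF summable_bound]) (use F_term_bound in auto)

lemma summable_E_term: "summable (E_term x j)"
  by (rule summable_comparison_test'[OF summable_bound]) (use E_term_bound in auto)

text \<open>The factor \<open>1 - x ^ r\<close> makes \<open>v 0\<close> vanish, so the telescoping
  series leaves no boundary term.\<close>

lemma suminf_telescope_eq_0:
  assumes "\<And>r. v r = (-1) ^ r * x ^ (e r) * (1 - x ^ r) * (qpoch x (r + j) / qpoch x r)" "\<And>r. r \<le> e r"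
  shows "(\<lambda>r. v r - v (Suc r)) sums 0"
proof -
  have "v \<longlonglongrightarrow> 0"
  proof (rule Lim_null_comparison)
    show "(\<lambda>r. 1 / qpoch_inf x 1 1 * x ^ r) \<longlonglongrightarrow> 0" by (rule summable_LIMSEQ_zero[OF summable_bound])
    show "\<forall>\<^sub>F r in sequentially. norm (v r) \<le> 1 / qpoch_inf x 1 1 * x ^ r"
      using telescoping_bound[OF assms(2) one_minus_power_bound] by (simp add: assms(1))
  qed
  from telescope_sums'[OF this] show ?thesis by (simp add: assms(1))
qed

lemma qpoch_shift:
  "(1 - x ^ Suc r) * (qpoch x (Suc r + j) / qpoch x (Suc r)) = (1 - x ^ (Suc r + j)) * (qpoch x (r + j) / qpoch x r)"
  "qpoch x (r + Suc j) = (1 - x ^ (Suc r + j)) * qpoch x (r + j)"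
proof -
  have "1 - x ^ Suc r \<noteq> 0" using power_Suc_less_one[OF x, of r] by linarith
  then show "(1 - x ^ Suc r) * (qpoch x (Suc r + j) / qpoch x (Suc r)) = (1 - x ^ (Suc r + j)) * (qpoch x (r + j) / qpoch x r)"
    by (simp add: qpoch_Suc del: power_Suc)
qed (simp add: qpoch_Suc)

lemma suminf_E_term: "suminf (E_term x j) = suminf (F_term x (Suc j))"
proof -
  \<comment> \<open>In the term of E, 1 - x^(j+1+2r) = (1 - x^r) + x^r (1 - x^(j+1+r)). The first
    part gives \<open>v r\<close>; the second differs from the term of F at j + 1 by
    \<open>- v (Suc r)\<close>.\<close>
  define e where "e r = (2 * j + 1) * r + lam r" for r
  define v where "v r = (-1) ^ r * x ^ (e r) * (1 - x ^ r) * (qpoch x (r + j) / qpoch x r)" for r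
  have "E_term x j r - F_term x (Suc j) r = v r - v (Suc r)" for r
  proof -
    define Q where "Q = qpoch x (r + j) / qpoch x r"
    have v': "v (Suc r) = - ((-1) ^ r) * x ^ (e (Suc r)) * ((1 - x ^ (Suc r + j)) * Q)"
      unfolding v_def mult.assoc qpoch_shift by (simp add: Q_def)
    have F: "F_term x (Suc j) r = (-1) ^ r * x ^ (2 * Suc j * r + lam r) * (1 - x ^ (2 * (Suc j + 1 + 2 * r))) * ((1 - x ^ (Suc r + j)) * Q)"
      unfolding F_term_def qpoch_shift Q_def by simp
    show ?thesis
      unfolding v' F unfolding E_term_def v_def e_def Q_def[symmetric]
      by (simp add: algebra_simps power_add power_mult power2_eq_square numeral_eq_Suc power_mult_distrib)
  qed
  then have "(\<lambda>r. E_term x j r - F_term x (Suc j) r) sums 0"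
    using suminf_telescope_eq_0[of v e j] lam_ge by (simp add: v_def e_def trans_le_add2)
  then show ?thesis
    using sums_diff[OF summable_sums[OF summable_E_term] summable_sums[OF summable_F_term], of j "Suc j"]
    by (simp add: sums_iff)
qed

lemma suminf_F_term: "suminf (F_term x j) = suminf (E_term x j) + x ^ Suc j * suminf (E_term x (Suc j))"
proof -
  \<comment> \<open>The terms of F and E at j differ by a bracket that splits as (1 - x^r) +
    x^(j+1+3r) (1 - x^(j+1+r)). The first part gives \<open>v r\<close>; the second combines with
    the term of E at j + 1 to \<open>- v (Suc r)\<close>.\<close>
  define e where "e r = 2 * j * r + lam r" for r
  define v where "v r = (-1) ^ r * x ^ (e r) * (1 - x ^ r) * (qpoch x (r + j) / qpoch x r)" for r
  have "F_term x j r - E_term x j r - x ^ Suc j * E_term x (Suc j) r = v r - v (Suc r)" for r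
  proof -
    define Q where "Q = qpoch x (r + j) / qpoch x r"
    have v': "v (Suc r) = - ((-1) ^ r) * x ^ (e (Suc r)) * ((1 - x ^ (Suc r + j)) * Q)"
      unfolding v_def mult.assoc qpoch_shift by (simp add: Q_def)
    have E: "E_term x (Suc j) r = (-1) ^ r * x ^ ((2 * Suc j + 1) * r + lam r) * (1 - x ^ (Suc j + 1 + 2 * r)) * ((1 - x ^ (Suc r + j)) * Q)"
      unfolding E_term_def qpoch_shift Q_def by simp
    show ?thesis
      unfolding v' E unfolding F_term_def E_term_def v_def e_def Q_def[symmetric]
      by (simp add: algebra_simps power_add power_mult power2_eq_square numeral_eq_Suc power_mult_distrib)
  qed
  then have "(\<lambda>r. F_term x j r - E_term x j r - x ^ Suc j * E_term x (Suc j) r) sums 0"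
    using suminf_telescope_eq_0[of v e j] lam_ge by (simp add: v_def e_def trans_le_add2)
  then show ?thesis
    using sums_diff[OF sums_diff[OF summable_sums[OF summable_F_term] summable_sums[OF summable_E_term]]
        sums_mult[OF summable_sums[OF summable_E_term], of "x ^ Suc j"], of j j "Suc j"]
    by (simp add: sums_iff)
qed

lemma suminf_F_term_rec:
  "suminf (F_term x j) = suminf (F_term x (Suc j)) + x ^ Suc j * suminf (F_term x (Suc (Suc j)))"
  using suminf_F_term[of j] by (simp only: suminf_E_term)

text \<open>As j grows only the term r = 0 survives, since all others carry a factor
  \<open>x ^ j\<close>. The limit settles the sign of the sums for large j, from where positivity is
  carried back to small j.\<close>

lemma suminf_F_term_tendsto: "(\<lambda>j. suminf (F_term x j)) \<longlonglongrightarrow> qpoch_inf x 1 1"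
proof -
  define C where "C = 1 / qpoch_inf x 1 1"
  have C: "0 < C" using qpoch_inf_pos[OF x, of 1 1] by (simp add: C_def)
  have tail_bound: "\<bar>F_term x j (Suc r)\<bar> \<le> C * x ^ r * x ^ j" for j r
  proof -
    have "2 * j * Suc r + lam (Suc r) \<ge> r + j" using lam_ge[of r] by simp
    then have "\<bar>F_term x j (Suc r)\<bar> \<le> 1 / qpoch_inf x 1 1 * x ^ (r + j)"
      unfolding F_term_def by (rule telescoping_bound[OF _ one_minus_power_bound])
    then show ?thesis by (simp add: C_def power_add mult_ac)
  qed
  have "(\<lambda>j. suminf (F_term x j) - F_term x j 0) \<longlonglongrightarrow> 0"
  proof (rule Lim_null_comparison)
    have s: "summable (\<lambda>r. C * x ^ r * x ^ j)" for j
      by (intro summable_mult summable_mult2 summable_geometric) (use x in auto)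
    have "\<bar>suminf (F_term x j) - F_term x j 0\<bar> \<le> C * (1 / (1 - x)) * x ^ j" for j
    proof -
      have "\<bar>suminf (F_term x j) - F_term x j 0\<bar> = \<bar>\<Sum>r. F_term x j (Suc r)\<bar>"
        using suminf_split_head[OF summable_F_term] by simp
      also have "\<dots> \<le> (\<Sum>r. C * x ^ r * x ^ j)"
        unfolding real_norm_def [symmetric] by (rule norm_suminf_le[OF _ s]) (simp add: tail_bound)
      also have "\<dots> = C * (1 / (1 - x)) * x ^ j"
        using x suminf_geometric[of x]
        by (simp add: suminf_mult suminf_mult2[symmetric] summable_geometric summable_mult)
      finally show ?thesis .
    qed
    then show "\<forall>\<^sub>F j in sequentially. norm (suminf (F_term x j) - F_term x j 0) \<le> C * (1 / (1 - x)) * x ^ j"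
      by simp
    show "(\<lambda>j. C * (1 / (1 - x)) * x ^ j) \<longlonglongrightarrow> 0"
      by (intro tendsto_mult_right_zero LIMSEQ_realpow_zero) (use x in auto)
  qed
  moreover have "(\<lambda>j. F_term x j 0) \<longlonglongrightarrow> qpoch_inf x 1 1"
  proof -
    have "(\<lambda>j. x ^ (2 * (j + 1))) \<longlonglongrightarrow> 0"
      using LIMSEQ_realpow_zero[of x] x
      by (intro filterlim_compose[OF LIMSEQ_realpow_zero[of x]] filterlim_subseq strict_monoI) auto
    from tendsto_mult[OF tendsto_diff[OF tendsto_const[of 1] this] qpoch_LIMSEQ[OF x]]
    show ?thesis by (simp add: F_term_def)
  qed
  ultimately have "(\<lambda>j. (suminf (F_term x j) - F_term x j 0) + F_term x j 0) \<longlonglongrightarrow> 0 + qpoch_inf x 1 1"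
    by (rule tendsto_add)
  then show ?thesis by simp
qed

lemma suminf_F_term_pos: "0 < suminf (F_term x j)"
proof -
  have "\<forall>\<^sub>F j in sequentially. 0 < suminf (F_term x j)"
    by (rule order_tendstoD[OF suminf_F_term_tendsto]) (use qpoch_inf_pos[OF x] in auto)
  then obtain N where N: "\<And>j. j \<ge> N \<Longrightarrow> 0 < suminf (F_term x j)"
    by (auto simp: eventually_sequentially)
  \<comment> \<open>Two consecutive indices travel together because the recurrence obtains each sum
    from the next two, with positive coefficients.\<close>
  have "0 < suminf (F_term x j) \<and> 0 < suminf (F_term x (Suc j))"
  proof (rule inc_induct[of j "max j N"])
    fix n assume "0 < suminf (F_term x (Suc n)) \<and> 0 < suminf (F_term x (Suc (Suc n)))"
    then show "0 < suminf (F_term x n) \<and> 0 < suminf (F_term x (Suc n))"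
      using x suminf_F_term_rec[of n] by (simp add: add_pos_pos)
  qed (use N in auto)
  then show ?thesis by simp
qed

lemma qpoch_inf_power: "qpoch_inf (x ^ 5) 1 1 = qpoch_inf x 5 5"
  unfolding qpoch_inf_def by (simp add: power_add mult.commute[of "x ^ 5"] flip: power_mult)

text \<open>The triple product with p = x^5 and z = x^a; the factors 1 - p^(k+1) / z are those of
  the residue class 5 - a.\<close>

lemma theta_product:
  assumes "0 < a" "a < 5"
  shows "qpoch_inf x 5 a * qpoch_inf x 5 (5 - a) * qpoch_inf x 5 5 =
    (\<Sum>r. (-1) ^ r * x powr (5 * real r * (real r - 1) / 2 + real a * real r) +
      (-1) ^ Suc r * x powr (5 * real (Suc r) * (real (Suc r) + 1) / 2 - real a * real (Suc r)))"
    (is "_ = suminf ?f")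
proof -
  have p: "0 < x ^ 5" "x ^ 5 < 1" using x power_less_one_iff[of x 5] by auto
  have z: "x ^ 5 < x ^ a" "x ^ a < 1"
    using x assms power_strict_decreasing[of a 5 x] power_less_one_iff[of x a] by auto
  have lim: "(\<lambda>n. \<Prod>k<n. (1 - x ^ a * (x ^ 5) ^ k) * (1 - (x ^ 5) ^ Suc k / x ^ a)) \<longlonglongrightarrow>
      qpoch_inf x 5 a * qpoch_inf x 5 (5 - a)"
  proof -
    have "(x ^ 5) ^ Suc k / x ^ a = x ^ (5 * k + (5 - a))" for k
    proof -
      have "5 * Suc k = (5 * k + (5 - a)) + a" using assms by simp
      then have "(x ^ 5) ^ Suc k = x ^ (5 * k + (5 - a)) * x ^ a"
        by (simp only: power_add [symmetric] power_mult [symmetric])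
      then show ?thesis using x by simp
    qed
    moreover have "x ^ a * (x ^ 5) ^ k = x ^ (5 * k + a)" for k
      by (simp add: power_add power_mult)
    ultimately show ?thesis
      unfolding prod.distrib using assms
      by (simp only:) (intro tendsto_mult qpoch_inf_LIMSEQ x, auto)
  qed
  have sum: "(\<Sum>r. (-1) ^ r * (x ^ 5) powr (real r * (real r - 1) / 2) * (x ^ a) ^ r +
      (-1) ^ Suc r * (x ^ 5) powr (real (Suc r) * (real (Suc r) + 1) / 2) / (x ^ a) ^ Suc r) = suminf ?f"
  proof (rule suminf_cong)
    fix r
    have xa: "(x ^ a) ^ n = x powr (real a * real n)" for n
    proof -
      have "(x ^ a) ^ n = x ^ (a * n)" by (simp only: power_mult)
      also have "\<dots> = x powr real (a * n)" using x by (simp only: powr_realpow)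
      finally show ?thesis by simp
    qed
    have x5: "(x ^ 5) powr b = x powr (5 * b)" for b
    proof -
      have "x ^ 5 = x powr 5" using x by simp
      then show ?thesis by (simp only: powr_powr)
    qed
    have e1: "x powr (5 * (b * c / 2)) * x powr d = x powr (5 * b * c / 2 + d)" for b c d :: real
      by (simp add: powr_add mult.assoc)
    have e2: "x powr (5 * (b * c / 2)) / x powr d = x powr (5 * b * c / 2 - d)" for b c d :: real
      by (simp add: powr_diff mult.assoc)
    show "(-1) ^ r * (x ^ 5) powr (real r * (real r - 1) / 2) * (x ^ a) ^ r +
      (-1) ^ Suc r * (x ^ 5) powr (real (Suc r) * (real (Suc r) + 1) / 2) / (x ^ a) ^ Suc r = ?f r"
      unfolding xa x5 mult.assoc[of "(-1) ^ r"] times_divide_eq_right[of "(-1) ^ Suc r", symmetric] e1 e2 ..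
  qed
  have "qpoch_inf x 5 a * qpoch_inf x 5 (5 - a) = suminf ?f / qpoch_inf x 5 5"
    using LIMSEQ_unique[OF lim jacobi_triple_product[OF p z]] unfolding qpoch_inf_power sum .
  then show ?thesis using qpoch_inf_pos[OF x, of 5 5] by (simp add: field_simps)
qed

text \<open>Taking a = 3 rather than 2 in \<open>theta_product\<close> turns the exponent 5 r (r -
  1) / 2 + 3 r into \<open>lam r\<close>, so the two series agree term by term.\<close>

lemma suminf_F_term_0: "suminf (F_term x 0) = qpoch_inf x 5 2 * qpoch_inf x 5 3 * qpoch_inf x 5 5"
proof -
  have pw: "x ^ n = x powr real n" for n using x by (simp add: powr_realpow)
  have "F_term x 0 = (\<lambda>r. (-1) ^ r * x powr (5 * real r * (real r - 1) / 2 + real 3 * real r) +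
      (-1) ^ Suc r * x powr (5 * real (Suc r) * (real (Suc r) + 1) / 2 - real 3 * real (Suc r)))"
  proof (rule ext)
    fix r
    have "F_term x 0 r = (-1) ^ r * (x ^ lam r - x ^ (lam r + 2 * (1 + 2 * r)))"
      using qpoch_pos[OF x, of r] by (simp add: F_term_def right_diff_distrib power_add mult_ac)
    moreover have "real (lam r) = 5 * real r * (real r - 1) / 2 + real 3 * real r"
      by (simp add: real_lam field_simps)
    moreover have "real (lam r + 2 * (1 + 2 * r)) = 5 * real (Suc r) * (real (Suc r) + 1) / 2 - real 3 * real (Suc r)"
      by (simp add: real_lam field_simps)
    ultimately show "F_term x 0 r = (-1) ^ r * x powr (5 * real r * (real r - 1) / 2 + real 3 * real r) +
      (-1) ^ Suc r * x powr (5 * real (Suc r) * (real (Suc r) + 1) / 2 - real 3 * real (Suc r))"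
      unfolding pw by (simp only: power_Suc) (simp add: algebra_simps)
  qed
  then have "suminf (F_term x 0) = qpoch_inf x 5 3 * qpoch_inf x 5 (5 - 3) * qpoch_inf x 5 5"
    by (simp only: theta_product[of 3])
  then show ?thesis by (simp add: mult_ac)
qed

text \<open>\<open>E_term x 0\<close> has the same sum and is used instead: at j = 0 its quotient of
  q-factorials is 1, which leaves a plain theta series.\<close>

lemma suminf_F_term_1: "suminf (F_term x 1) = qpoch_inf x 5 1 * qpoch_inf x 5 4 * qpoch_inf x 5 5"
proof -
  have pw: "x ^ n = x powr real n" for n using x by (simp add: powr_realpow)
  have "E_term x 0 = (\<lambda>r. (-1) ^ r * x powr (5 * real r * (real r - 1) / 2 + real 4 * real r) +
      (-1) ^ Suc r * x powr (5 * real (Suc r) * (real (Suc r) + 1) / 2 - real 4 * real (Suc r)))"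
  proof (rule ext)
    fix r
    have "E_term x 0 r = (-1) ^ r * (x ^ (r + lam r) - x ^ (r + lam r) * x ^ (1 + 2 * r))"
      using qpoch_pos[OF x, of r] by (simp add: E_term_def right_diff_distrib mult.assoc)
    then have "E_term x 0 r = (-1) ^ r * (x ^ (r + lam r) - x ^ (r + lam r + (1 + 2 * r)))"
      by (simp only: power_add)
    moreover have "real (r + lam r) = 5 * real r * (real r - 1) / 2 + real 4 * real r"
      by (simp add: real_lam field_simps)
    moreover have "real (r + lam r + (1 + 2 * r)) = 5 * real (Suc r) * (real (Suc r) + 1) / 2 - real 4 * real (Suc r)"
      by (simp add: real_lam field_simps)
    ultimately show "E_term x 0 r = (-1) ^ r * x powr (5 * real r * (real r - 1) / 2 + real 4 * real r) +
      (-1) ^ Suc r * x powr (5 * real (Suc r) * (real (Suc r) + 1) / 2 - real 4 * real (Suc r))"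
      unfolding pw by (simp only: power_Suc) (simp add: algebra_simps)
  qed
  then have "suminf (E_term x 0) = qpoch_inf x 5 4 * qpoch_inf x 5 (5 - 4) * qpoch_inf x 5 5"
    by (simp only: theta_product[of 4])
  then show ?thesis using suminf_E_term[of 0] by (simp add: mult_ac)
qed

theorem RR_eq_product:
  "RR x = x powr (1/5) * (qpoch_inf x 5 1 * qpoch_inf x 5 4) / (qpoch_inf x 5 2 * qpoch_inf x 5 3)"
proof -
  have "(\<lambda>n. rr_tail x n 0) \<longlonglongrightarrow> suminf (F_term x 0) / suminf (F_term x 1)"
    by (rule rr_tail_tendsto[OF x suminf_F_term_pos suminf_F_term_rec])
  then have "RR x = x powr (1/5) / (suminf (F_term x 0) / suminf (F_term x 1))"
    unfolding RR_def by (simp add: limI)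
  then show ?thesis
    unfolding suminf_F_term_0 suminf_F_term_1
    using qpoch_inf_pos[OF x, of 5 5] by (simp add: field_simps)
qed

end

subsection \<open>Bilateral Lambert series\<close>

lemma has_sum_Times_mult:
  fixes f :: "'a \<Rightarrow> real" and g :: "'b \<Rightarrow> real"
  assumes f: "(f has_sum a) A" and g: "(g has_sum b) B"
  shows "((\<lambda>(x, y). f x * g y) has_sum a * b) (A \<times> B)"
proof (rule has_sum_SigmaI)
  show "((\<lambda>y. case (x, y) of (x, y) \<Rightarrow> f x * g y) has_sum f x * b) B" for x
    using has_sum_cmult_right[OF g, of "f x"] by simp
  show "((\<lambda>x. f x * b) has_sum a * b) A"
    using has_sum_cmult_left[OF f, of b] by simp
  have "(\<lambda>x. norm (f x)) summable_on A" "(\<lambda>y. norm (g y)) summable_on B"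
    using f g by (auto simp: summable_on_iff_abs_summable_on_real[symmetric] simp del: real_norm_def dest: has_sum_imp_summable)
  then have "(\<lambda>(x, y). norm (f x) * norm (g y)) summable_on A \<times> B"
    by (intro summable_on_SigmaI[where g = "\<lambda>x. norm (f x) * infsum (\<lambda>y. norm (g y)) B"])
      (auto intro!: has_sum_cmult_right summable_on_cmult_left has_sum_infsum)
  then have "(\<lambda>z. norm (case z of (x, y) \<Rightarrow> f x * g y)) summable_on A \<times> B"
    by (simp add: case_prod_unfold abs_mult)
  then show "(\<lambda>(x, y). f x * g y) summable_on A \<times> B"
    by (rule abs_summable_summable)
qed

lemma has_sum_int_split:
  fixes f :: "int \<Rightarrow> real"
  assumes pos: "((\<lambda>n. f (int (Suc n))) has_sum a) UNIV" and neg: "((\<lambda>n. f (- int (Suc n))) has_sum b) UNIV"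
  shows "(f has_sum f 0 + a + b) UNIV"
proof -
  have r1: "range (\<lambda>n. int (Suc n)) = {0<..}"
  proof (intro equalityI subsetI)
    fix k :: int assume "k \<in> {0<..}"
    then have "k = int (Suc (nat k - 1))" by simp
    then show "k \<in> range (\<lambda>n. int (Suc n))" by (rule range_eqI)
  qed auto
  have r2: "range (\<lambda>n. - int (Suc n)) = {..<0}"
  proof (intro equalityI subsetI)
    fix k :: int assume "k \<in> {..<0}"
    then have "k = - int (Suc (nat (- k) - 1))" by simp
    then show "k \<in> range (\<lambda>n. - int (Suc n))" by (rule range_eqI)
  qed auto
  have "(f has_sum a) {0<..}"
    using pos unfolding r1[symmetric] by (subst has_sum_reindex) (auto intro!: inj_onI simp: o_def)
  moreover have "(f has_sum b) {..<0}"
    using neg unfolding r2[symmetric] by (subst has_sum_reindex) (auto intro!: inj_onI simp: o_def)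
  ultimately have "(f has_sum (a + b)) ({0<..} \<union> {..<0})"
    by (intro has_sum_Un_disjoint) auto
  then have "(f has_sum f 0 + (a + b)) (insert 0 ({0<..} \<union> {..<0}))"
    by (intro has_sum_insert) auto
  moreover have "insert 0 ({0<..} \<union> {..<0}) = (UNIV :: int set)" by auto
  ultimately show ?thesis by (simp add: add.assoc)
qed

text \<open>The linear factor in the bound leaves room for series differentiated once, whose
  coefficients carry an extra n.\<close>

lemma summable_on_int_bound:
  fixes f :: "int \<Rightarrow> real"
  assumes \<rho>: "0 \<le> \<rho>" "\<rho> < 1" and bound: "\<And>n. \<bar>f n\<bar> \<le> C * (1 + real (nat \<bar>n\<bar>)) * \<rho> ^ nat \<bar>n\<bar>"
  shows "f summable_on UNIV"
proof -
  define b where "b n = C * (1 + real n) * \<rho> ^ n" for n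
  have b_nonneg: "0 \<le> b (nat \<bar>n\<bar>)" for n :: int using bound[of n] by (simp add: b_def)
  then have b_nonneg': "0 \<le> b n" for n by (metis abs_of_nat nat_int)
  have "summable (\<lambda>n. C * ((of_nat (Suc n) * \<rho> ^ n)))"
    using \<rho> termdiff_converges[of \<rho> 1 "\<lambda>_. 1"] by (intro summable_mult) (auto simp: diffs_def summable_geometric)
  then have "summable b" by (simp add: b_def[abs_def] mult_ac)
  then have "(\<lambda>n. b (Suc n)) sums (suminf (\<lambda>n. b (Suc n)))"
    by (simp only: summable_Suc_iff summable_sums)
  then have "((\<lambda>n. b (Suc n)) has_sum suminf (\<lambda>n. b (Suc n))) UNIV"
    using b_nonneg' by (intro norm_summable_imp_has_sum) (auto simp: sums_iff)
  then have "((\<lambda>n. b (nat \<bar>n\<bar>)) has_sum (b (nat \<bar>0\<bar>) + suminf (\<lambda>n. b (Suc n)) + suminf (\<lambda>n. b (Suc n)))) UNIV"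
    by (intro has_sum_int_split[of "\<lambda>n. b (nat \<bar>n\<bar>)"]) (simp_all add: nat_add_distrib)
  then have "(\<lambda>n. b (nat \<bar>n\<bar>)) summable_on UNIV" by (rule has_sum_imp_summable)
  then have "(\<lambda>n. norm (f n)) summable_on UNIV"
    by (rule summable_on_comparison_test) (use bound in \<open>auto simp: b_def\<close>)
  then show ?thesis by (rule abs_summable_summable)
qed

lemma has_sum_diff_real:
  fixes f g :: "'a \<Rightarrow> real"
  assumes "(f has_sum a) A" "(g has_sum b) A"
  shows "((\<lambda>x. f x - g x) has_sum a - b) A"
  using has_sum_add[OF assms(1) has_sum_uminusI[OF assms(2)]] by simp

lemma has_sum_uminus_int: "((\<lambda>n::int. f (- n)) has_sum s) UNIV \<longleftrightarrow> (f has_sum s) UNIV"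
  by (rule has_sum_reindex_bij_witness[of _ uminus uminus]) auto

lemma has_sum_single_int: "((\<lambda>n::int. if n = a then c else 0) has_sum c) UNIV"
  by (rule has_sum_finite_neutralI[of "{a}"]) auto

text \<open>The value \<open>lc p 0 = 1/2\<close> makes \<open>lc p n + lc p (- n) = 1\<close> hold for all \<open>n\<close>,
  and \<open>ld p 0 = 1/12\<close> makes the addition formula below symmetric.\<close>

definition lc :: "real \<Rightarrow> int \<Rightarrow> real" where
  "lc p n = (if n = 0 then 1/2 else 1 / (1 - p powi n))"

definition ld :: "real \<Rightarrow> int \<Rightarrow> real" where
  "ld p n = (if n = 0 then 1/12 else lc p n * lc p (- n))"

text \<open>Put theta(x) = (x; p) (p/x; p). On p < x < 1, \<open>Zs\<close> is 1/2 - x d/dx log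
  theta and \<open>Ws\<close> is 1/12 + p d/dp log theta. \<open>dZs\<close> and \<open>dWs\<close>
  are their images under x d/dx, and p d/dp sends \<open>Zs\<close> to minus
  \<open>dWs\<close>.\<close>

definition Zs :: "real \<Rightarrow> real \<Rightarrow> real" where
  "Zs p x = (\<Sum>\<^sub>\<infinity>n. lc p n * x powi n)"

definition Ws :: "real \<Rightarrow> real \<Rightarrow> real" where
  "Ws p x = (\<Sum>\<^sub>\<infinity>n. ld p n * x powi n)"

definition dZs :: "real \<Rightarrow> real \<Rightarrow> real" where
  "dZs p x = (\<Sum>\<^sub>\<infinity>n. of_int n * lc p n * x powi n)"

definition dWs :: "real \<Rightarrow> real \<Rightarrow> real" where
  "dWs p x = (\<Sum>\<^sub>\<infinity>n. of_int n * ld p n * x powi n)"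

context
  fixes p :: real
  assumes p: "0 < p" "p < 1"
begin

lemma powi_ne_1: "n \<noteq> 0 \<Longrightarrow> p powi n \<noteq> 1"
proof -
  assume n: "n \<noteq> 0"
  have *: "p ^ k \<noteq> 1" if "k > 0" for k
    using power_less_one_iff[of p k] p that by (metis less_irrefl less_imp_le)
  show ?thesis
  proof (cases "n > 0")
    case True
    then show ?thesis using *[of "nat n"] by (simp add: power_int_def)
  next
    case False
    then show ?thesis using *[of "nat (- n)"] n by (simp add: power_int_def power_inverse)
  qed
qed

lemma lc_minus: "lc p (- n) = 1 - lc p n"
proof (cases "n = 0")
  case False
  have "p powi n \<noteq> 1" "p powi n \<noteq> 0" using powi_ne_1[OF False] p by auto
  then show ?thesis using False by (simp add: lc_def power_int_minus field_simps)
qed (simp add: lc_def)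

text \<open>For u = p^m and v = p^n the bracket on the right is (1 - u v) / ((1 - u) (1 - v)). This
  partial fraction is the source of every relation between the series.\<close>

lemma lc_mult:
  assumes "m \<noteq> 0" "n \<noteq> 0" "m + n \<noteq> 0"
  shows "lc p m * lc p n = lc p (m + n) * (lc p m + lc p n - 1)"
proof -
  have e: "p powi (m + n) = p powi m * p powi n" using p by (simp add: power_int_add)
  have "p powi m \<noteq> 1" "p powi n \<noteq> 1" "p powi m * p powi n \<noteq> 1"
    using assms powi_ne_1[of m] powi_ne_1[of n] powi_ne_1[of "m + n"] e by auto
  then show ?thesis using assms by (simp add: lc_def e divide_simps) (simp add: algebra_simps)
qed

lemma ld_minus: "ld p (- n) = ld p n"
  by (simp add: ld_def)

lemma ld_eq: "n \<noteq> 0 \<Longrightarrow> ld p n = lc p n * (1 - lc p n)"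
  by (simp add: ld_def lc_minus)

text \<open>Partial fractions make the Laurent coefficients of the elliptic addition formula cancel
  off the three lines \<open>M = 0\<close>, \<open>N = 0\<close>, \<open>M = N\<close>.\<close>

lemma lc_bilinear:
  "lc p M * lc p N - lc p N * lc p (M - N) - lc p M * lc p (N - M) =
    - ((if N = 0 then ld p M else 0) + (if M = 0 then ld p N else 0) + (if M = N then ld p M else 0))"
proof -
  have NM: "lc p (N - M) = 1 - lc p (M - N)" using lc_minus[of "M - N"] by simp
  have h: "lc p 0 = 1/2" "ld p 0 = 1/12" by (simp_all add: lc_def ld_def)
  show ?thesis
  proof (cases "M = 0 \<or> N = 0 \<or> M = N")
    \<comment> \<open>At M = N = 0 the left side is 1/4 - 1/4 - 1/4 and all three lines meet, whence
      the value 1/12 of \<open>ld p 0\<close>.\<close>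
    case True
    then show ?thesis
      by (auto simp: h ld_eq lc_minus algebra_simps)
  next
    case False
    then have "lc p (M - N) * lc p N = lc p M * (lc p (M - N) + lc p N - 1)"
      using lc_mult[of "M - N" N] by auto
    then show ?thesis using False unfolding NM by (simp add: algebra_simps)
  qed
qed

lemma lc_convolution_0: "lc p m * lc p (- m) = ld p m + (if m = 0 then 1/6 else 0)"
  by (simp add: ld_def lc_def)

text \<open>Prepares the coefficients of a square: the difference on the right telescopes in m, and
  the corrections at m = 0 and m = n account for the half value \<open>lc p 0\<close>.\<close>

lemma lc_convolution:
  assumes "n \<noteq> 0"
  shows "lc p m * lc p (n - m) = lc p n * (lc p m - lc p (m - n)) + (if m = 0 then ld p n else 0) + (if m = n then ld p n else 0)"
proof -
  have h: "lc p 0 = 1/2" by (simp add: lc_def)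
  have nm: "lc p (n - m) = 1 - lc p (m - n)" using lc_minus[of "m - n"] by simp
  show ?thesis
  proof (cases "m = 0 \<or> m = n")
    case True
    then show ?thesis using assms by (auto simp: h ld_eq lc_minus field_simps)
  next
    case False
    then have "lc p m * lc p (n - m) = lc p n * (lc p m + lc p (n - m) - 1)"
      using lc_mult[of m "n - m"] assms by auto
    then show ?thesis using False by (simp add: nm algebra_simps)
  qed
qed

lemma lc_bound: "\<bar>lc p n\<bar> \<le> 1 / (1 - p) * (if n < 0 then p ^ nat \<bar>n\<bar> else 1)"
proof -
  have b: "1 / (1 - p ^ k) \<le> 1 / (1 - p)" if "k > 0" for k
    using that p power_decreasing[of 1 k p] by (intro frac_le) auto
  have b0: "0 < 1 - p ^ k" if "k > 0" for k
    using that p power_less_one_iff[of p k] by simp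
  consider "n = 0" | k where "k > 0" "n = int k" | k where "k > 0" "n = - int k"
    by (metis int_cases2 linorder_cases neg_0_less_iff_less of_nat_0_less_iff zero_less_imp_eq_int minus_equation_iff)
  then show ?thesis
  proof cases
    case 1
    have "1 / 2 \<le> 1 / (1 - p)" using p by (simp add: field_simps)
    then show ?thesis using 1 by (simp add: lc_def)
  next
    case 2
    then show ?thesis using b[of k] b0[of k] by (simp add: lc_def)
  next
    case 3
    have "lc p n = 1 - 1 / (1 - p ^ k)" using 3 lc_minus[of "int k"] by (simp add: lc_def)
    also have "\<dots> = - (p ^ k * (1 / (1 - p ^ k)))" using b0[of k] 3 by (simp add: field_simps)
    finally have "\<bar>lc p n\<bar> = p ^ k * (1 / (1 - p ^ k))" using b0[of k] 3 p by (simp add: abs_mult)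
    also have "\<dots> \<le> p ^ k * (1 / (1 - p))" using b[of k] 3 p by (intro mult_left_mono) auto
    finally show ?thesis using 3 by (simp add: mult.commute)
  qed
qed

lemma ld_bound: "\<bar>ld p n\<bar> \<le> 1 / (1 - p)\<^sup>2 * p ^ nat \<bar>n\<bar>"
proof (cases "n = 0")
  case True
  have "(1 - p)\<^sup>2 \<le> 1" using p by (simp add: power_le_one)
  then have "1 / 12 \<le> 1 / (1 - p)\<^sup>2" using p by (simp add: field_simps)
  then show ?thesis using True by (simp add: ld_def)
next
  case False
  have "\<bar>ld p n\<bar> = \<bar>lc p n\<bar> * \<bar>lc p (- n)\<bar>" using False by (simp add: ld_def abs_mult)
  also have "\<dots> \<le> (1 / (1 - p) * (if n < 0 then p ^ nat \<bar>n\<bar> else 1)) * (1 / (1 - p) * (if - n < 0 then p ^ nat \<bar>- n\<bar> else 1))"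
    by (intro mult_mono lc_bound) (use p in auto)
  also have "\<dots> = 1 / (1 - p)\<^sup>2 * p ^ nat \<bar>n\<bar>" using False by (auto simp: power2_eq_square)
  finally show ?thesis .
qed

context
  fixes x :: real
  assumes x: "p < x" "x < 1"
begin

text \<open>\<open>lc\<close> tends to 1 at plus infinity and decays like p^|n| at minus infinity,
  which is why the series live on p < x < 1. The larger of x and p / x bounds both ends
  geometrically.\<close>

lemma laurent_powi: 
  defines "\<rho> \<equiv> max x (p / x)"
  shows "0 \<le> \<rho>" "\<rho> < 1" "(if n < 0 then p ^ nat \<bar>n\<bar> else 1) * x powi n \<le> \<rho> ^ nat \<bar>n\<bar>"
    "p ^ nat \<bar>n\<bar> * x powi n \<le> \<rho> ^ nat \<bar>n\<bar>" "0 < x powi n"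
proof -
  have x0: "0 < x" using p x by linarith
  show "0 \<le> \<rho>" "\<rho> < 1" using x0 x p by (auto simp: \<rho>_def)
  show "0 < x powi n" using x0 by simp
  have 1: "(if n < 0 then p ^ nat \<bar>n\<bar> else 1) * x powi n \<le> \<rho> ^ nat \<bar>n\<bar>"
  proof (cases "n < 0")
    case True
    then have "p ^ nat \<bar>n\<bar> * x powi n = (p / x) ^ nat \<bar>n\<bar>"
      using x0 by (simp add: power_int_def power_divide field_simps)
    also have "\<dots> \<le> \<rho> ^ nat \<bar>n\<bar>" using x0 p by (intro power_mono) (auto simp: \<rho>_def)
    finally show ?thesis using True by simp
  next
    case False
    then show ?thesis using x0 by (auto simp: power_int_def \<rho>_def intro!: power_mono)
  qed
  then show "(if n < 0 then p ^ nat \<bar>n\<bar> else 1) * x powi n \<le> \<rho> ^ nat \<bar>n\<bar>" .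
  have "p ^ nat \<bar>n\<bar> * x powi n \<le> (if n < 0 then p ^ nat \<bar>n\<bar> else 1) * x powi n"
    using p \<open>0 < x powi n\<close> by (intro mult_right_mono) (auto simp: power_le_one)
  then show "p ^ nat \<bar>n\<bar> * x powi n \<le> \<rho> ^ nat \<bar>n\<bar>" using 1 by linarith
qed

lemma laurent_summable:
  assumes "\<And>n. \<bar>f n\<bar> \<le> C * (1 + real (nat \<bar>n\<bar>)) * (if n < 0 then p ^ nat \<bar>n\<bar> else 1)" "0 \<le> C"
  shows "(\<lambda>n. f n * x powi n) summable_on UNIV"
proof (rule summable_on_int_bound[OF laurent_powi(1,2)])
  fix n
  have "\<bar>f n * x powi n\<bar> = \<bar>f n\<bar> * x powi n" using laurent_powi(5)[of n] by (simp add: abs_mult)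
  also have "\<dots> \<le> (C * (1 + real (nat \<bar>n\<bar>)) * (if n < 0 then p ^ nat \<bar>n\<bar> else 1)) * x powi n"
    by (rule mult_right_mono[OF assms(1)]) (use laurent_powi(5)[of n] in auto)
  also have "\<dots> = (C * (1 + real (nat \<bar>n\<bar>))) * ((if n < 0 then p ^ nat \<bar>n\<bar> else 1) * x powi n)"
    by (simp add: mult_ac)
  also have "\<dots> \<le> (C * (1 + real (nat \<bar>n\<bar>))) * max x (p / x) ^ nat \<bar>n\<bar>"
    by (rule mult_left_mono[OF laurent_powi(3)]) (use assms(2) in auto)
  finally show "\<bar>f n * x powi n\<bar> \<le> C * (1 + real (nat \<bar>n\<bar>)) * max x (p / x) ^ nat \<bar>n\<bar>" .
qed

lemma Zs: "((\<lambda>n. lc p n * x powi n) has_sum Zs p x) UNIV"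
  and dZs: "((\<lambda>n. of_int n * lc p n * x powi n) has_sum dZs p x) UNIV"
  and Ws: "((\<lambda>n. ld p n * x powi n) has_sum Ws p x) UNIV"
  and dWs: "((\<lambda>n. of_int n * ld p n * x powi n) has_sum dWs p x) UNIV"
proof -
  define i where "i n = (if n < 0 then p ^ nat \<bar>n\<bar> else 1)" for n :: int
  have i0: "0 \<le> i n" for n using p by (simp add: i_def)
  have *: "\<bar>f n\<bar> \<le> C * (1 + real (nat \<bar>n\<bar>)) * i n" "\<bar>of_int n * f n\<bar> \<le> C * (1 + real (nat \<bar>n\<bar>)) * i n"
    if "\<bar>f n\<bar> \<le> C * i n" "0 \<le> C" for f :: "int \<Rightarrow> real" and C n
  proof -
    have "1 * \<bar>f n\<bar> \<le> (1 + real (nat \<bar>n\<bar>)) * (C * i n)" using that i0 by (intro mult_mono) auto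
    then show "\<bar>f n\<bar> \<le> C * (1 + real (nat \<bar>n\<bar>)) * i n" by (simp add: mult_ac)
    have "\<bar>of_int n\<bar> * \<bar>f n\<bar> \<le> (1 + real (nat \<bar>n\<bar>)) * (C * i n)" using that i0 by (intro mult_mono) auto
    then show "\<bar>of_int n * f n\<bar> \<le> C * (1 + real (nat \<bar>n\<bar>)) * i n" by (simp add: mult_ac abs_mult)
  qed
  have lc: "\<bar>lc p n\<bar> \<le> 1 / (1 - p) * i n" for n using lc_bound by (simp add: i_def)
  have ld: "\<bar>ld p n\<bar> \<le> 1 / (1 - p)\<^sup>2 * i n" for n
  proof (rule order.trans[OF ld_bound mult_left_mono])
    show "p ^ nat \<bar>n\<bar> \<le> i n" using p by (auto simp: i_def power_le_one)
  qed auto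
  show "((\<lambda>n. lc p n * x powi n) has_sum Zs p x) UNIV"
    unfolding Zs_def by (intro has_sum_infsum laurent_summable[OF *(1)[where f = "lc p", OF lc, unfolded i_def]]) (use p in auto)
  show "((\<lambda>n. of_int n * lc p n * x powi n) has_sum dZs p x) UNIV"
    unfolding dZs_def by (intro has_sum_infsum laurent_summable[OF *(2)[where f = "lc p", OF lc, unfolded i_def]]) (use p in auto)
  show "((\<lambda>n. ld p n * x powi n) has_sum Ws p x) UNIV"
    unfolding Ws_def by (intro has_sum_infsum laurent_summable[OF *(1)[where f = "ld p", OF ld, unfolded i_def]]) (use p in auto)
  show "((\<lambda>n. of_int n * ld p n * x powi n) has_sum dWs p x) UNIV"
    unfolding dWs_def by (intro has_sum_infsum laurent_summable[OF *(2)[where f = "ld p", OF ld, unfolded i_def]]) (use p in auto)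
qed

lemma laurent_reflect_bounds: "p < p / x" "p / x < 1"
  using p x by (auto simp: field_simps)

lemma powi_reflect: "(p / x) powi (- n) = p powi (- n) * x powi n"
  by (simp add: power_int_divide_distrib power_int_minus) (simp add: divide_inverse mult.commute)

lemma lc_reflect:
  assumes "n \<noteq> 0"
  shows "lc p (- n) * (p / x) powi (- n) = - (lc p n * x powi n)"
    and "ld p (- n) * (p / x) powi (- n) = (ld p n - lc p n) * x powi n"
proof -
  have "p powi n \<noteq> 1" "p powi n \<noteq> 0" using powi_ne_1[OF assms] p by auto
  then have e: "lc p (- n) * p powi (- n) = - lc p n"
    using assms by (simp add: lc_def power_int_minus field_simps)
  then show "lc p (- n) * (p / x) powi (- n) = - (lc p n * x powi n)"
    unfolding powi_reflect by (simp add: mult.assoc[symmetric])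
  have "ld p (- n) * p powi (- n) = lc p n * (lc p (- n) * p powi (- n))"
    using assms by (simp add: ld_def)
  also have "\<dots> = ld p n - lc p n" unfolding e using assms by (simp add: ld_eq algebra_simps)
  finally show "ld p (- n) * (p / x) powi (- n) = (ld p n - lc p n) * x powi n"
    unfolding powi_reflect by (simp add: mult.assoc[symmetric])
qed

end

text \<open>Every index n other than 0 is matched with -n; the constants 1 and 1/2 only repair the
  coefficient of index 0. The reflection brings q^3 = p / q^2 back to q^2.\<close>

lemma
  assumes x: "p < x" "x < 1"
  shows Zs_reflect: "Zs p (p / x) = 1 - Zs p x"
    and dZs_reflect: "dZs p (p / x) = dZs p x"
    and Ws_reflect: "Ws p (p / x) = Ws p x - Zs p x + 1/2"
    and dWs_reflect: "dWs p (p / x) = dZs p x - dWs p x"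
proof -
  note x' = laurent_reflect_bounds[OF x]
  have "((\<lambda>n. lc p (- n) * (p / x) powi (- n)) has_sum (- Zs p x + 1)) UNIV"
  proof (rule has_sum_cong[THEN iffD1, OF _ has_sum_add[OF has_sum_uminusI[OF Zs[OF x]] has_sum_single_int[of 0 1]]])
    show "- (lc p n * x powi n) + (if n = 0 then 1 else 0) = lc p (- n) * (p / x) powi (- n)" for n
    proof (cases "n = 0")
      case False
      then show ?thesis unfolding lc_reflect(1)[OF x False] by simp
    qed (simp add: lc_def)
  qed
  then show "Zs p (p / x) = 1 - Zs p x"
    using has_sum_unique[OF Zs[OF x'] has_sum_uminus_int[of "\<lambda>n. lc p n * (p / x) powi n", THEN iffD1]] by simp
  have "((\<lambda>n. of_int (- n) * lc p (- n) * (p / x) powi (- n)) has_sum dZs p x) UNIV"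
  proof (rule has_sum_cong[THEN iffD1, OF _ dZs[OF x]])
    show "of_int n * lc p n * x powi n = of_int (- n) * lc p (- n) * (p / x) powi (- n)" for n
    proof (cases "n = 0")
      case False
      then show ?thesis unfolding mult.assoc lc_reflect(1)[OF x False] by simp
    qed simp
  qed
  then show "dZs p (p / x) = dZs p x"
    using has_sum_unique[OF dZs[OF x'] has_sum_uminus_int[of "\<lambda>n. of_int n * lc p n * (p / x) powi n", THEN iffD1]] by simp
  have "((\<lambda>n. ld p (- n) * (p / x) powi (- n)) has_sum (Ws p x - Zs p x + 1/2)) UNIV"
  proof (rule has_sum_cong[THEN iffD1, OF _ has_sum_add[OF has_sum_diff_real[OF Ws[OF x] Zs[OF x]] has_sum_single_int[of 0 "1/2"]]])
    show "ld p n * x powi n - lc p n * x powi n + (if n = 0 then 1/2 else 0) = ld p (- n) * (p / x) powi (- n)" for n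
    proof (cases "n = 0")
      case False
      then show ?thesis unfolding lc_reflect(2)[OF x False] by (simp add: algebra_simps)
    qed (simp add: lc_def)
  qed
  then show "Ws p (p / x) = Ws p x - Zs p x + 1/2"
    using has_sum_unique[OF Ws[OF x'] has_sum_uminus_int[of "\<lambda>n. ld p n * (p / x) powi n", THEN iffD1]] by simp
  have "((\<lambda>n. of_int (- n) * ld p (- n) * (p / x) powi (- n)) has_sum (dZs p x - dWs p x)) UNIV"
  proof (rule has_sum_cong[THEN iffD1, OF _ has_sum_diff_real[OF dZs[OF x] dWs[OF x]]])
    show "of_int n * lc p n * x powi n - of_int n * ld p n * x powi n = of_int (- n) * ld p (- n) * (p / x) powi (- n)" for n
    proof (cases "n = 0")
      case False
      then show ?thesis unfolding mult.assoc lc_reflect(2)[OF x False] by (simp add: algebra_simps)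
    qed simp
  qed
  then show "dWs p (p / x) = dZs p x - dWs p x"
    using has_sum_unique[OF dWs[OF x'] has_sum_uminus_int[of "\<lambda>n. of_int n * ld p n * (p / x) powi n", THEN iffD1]] by simp
qed

end

section \<open>Addition relations by comparing double series\<close>

context
  fixes x y :: real
  assumes xy: "0 < x" "0 < y"
begin

text \<open>With the two reindexed versions below, the products Z(x) Z(y), Z(x y) Z(x) and Z(x y)
  Z(y) are all expanded in the monomials x^M y^N, so a relation between them can be checked on
  coefficients.\<close>

lemma has_sum_product_lattice:
  assumes "((\<lambda>m. a m * x powi m) has_sum s) UNIV" "((\<lambda>m. b m * y powi m) has_sum t) UNIV"
  shows "((\<lambda>(M, N). a M * b N * (x powi M * y powi N)) has_sum s * t) UNIV"
  using has_sum_Times_mult[OF assms] by (simp add: mult_ac case_prod_unfold)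

lemma has_sum_product_lattice_left:
  assumes "((\<lambda>m. a m * (x * y) powi m) has_sum s) UNIV" "((\<lambda>m. b m * x powi m) has_sum t) UNIV"
  shows "((\<lambda>(M, N). a N * b (M - N) * (x powi M * y powi N)) has_sum s * t) UNIV"
proof (rule has_sum_reindex_bij_witness[where i = "\<lambda>(M, N). (N, M - N)" and j = "\<lambda>(m, k). (m + k, m)", THEN iffD1, rotated -1])
  show "((\<lambda>(m, k). a m * (x * y) powi m * (b k * x powi k)) has_sum s * t) UNIV"
    using has_sum_Times_mult[OF assms] by simp
  show "(case (case z of (m, k) \<Rightarrow> (m + k, m)) of (M, N) \<Rightarrow> a N * b (M - N) * (x powi M * y powi N)) =
      (case z of (m, k) \<Rightarrow> a m * (x * y) powi m * (b k * x powi k))" for z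
    using xy by (simp add: case_prod_unfold power_int_add power_int_mult_distrib)
qed (auto simp: case_prod_unfold)

lemma has_sum_product_lattice_right:
  assumes "((\<lambda>m. a m * (x * y) powi m) has_sum s) UNIV" "((\<lambda>m. b m * y powi m) has_sum t) UNIV"
  shows "((\<lambda>(M, N). a M * b (N - M) * (x powi M * y powi N)) has_sum s * t) UNIV"
proof (rule has_sum_reindex_bij_witness[where i = "\<lambda>(M, N). (M, N - M)" and j = "\<lambda>(m, k). (m, m + k)", THEN iffD1, rotated -1])
  show "((\<lambda>(m, k). a m * (x * y) powi m * (b k * y powi k)) has_sum s * t) UNIV"
    using has_sum_Times_mult[OF assms] by simp
  show "(case (case z of (m, k) \<Rightarrow> (m, m + k)) of (M, N) \<Rightarrow> a M * b (N - M) * (x powi M * y powi N)) =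
      (case z of (m, k) \<Rightarrow> a m * (x * y) powi m * (b k * y powi k))" for z
    using xy by (simp add: case_prod_unfold power_int_add power_int_mult_distrib)
qed (auto simp: case_prod_unfold)

lemma has_sum_line:
  assumes f: "((\<lambda>m. f (\<phi> m)) has_sum s) UNIV" and inj: "inj \<phi>" and P: "\<And>z. P z \<longleftrightarrow> z \<in> range \<phi>"
  shows "((\<lambda>z. if P z then f z else (0::real)) has_sum s) UNIV"
proof -
  have "(f has_sum s) (range \<phi>)"
    using f inj by (subst has_sum_reindex) (auto simp: o_def)
  then show ?thesis
    by (rule has_sum_cong_neutral[THEN iffD1, rotated -1]) (auto simp: P)
qed

lemma has_sum_three_lines:
  assumes a: "((\<lambda>m. a m * x powi m) has_sum s) UNIV" and b: "((\<lambda>m. b m * y powi m) has_sum t) UNIV"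
    and c: "((\<lambda>m. c m * (x * y) powi m) has_sum u) UNIV"
  shows "((\<lambda>(M, N). ((if N = 0 then a M else 0) + (if M = 0 then b N else 0) + (if M = N then c M else 0)) *
    (x powi M * y powi N)) has_sum (s + t + u)) UNIV"
proof -
  have 1: "((\<lambda>z. if snd z = 0 then a (fst z) * (x powi fst z * y powi snd z) else 0) has_sum s) UNIV"
    by (rule has_sum_line[of _ "\<lambda>m. (m, 0)"]) (use a in \<open>auto intro: inj_onI simp: image_iff prod_eq_iff\<close>)
  have 2: "((\<lambda>z. if fst z = 0 then b (snd z) * (x powi fst z * y powi snd z) else 0) has_sum t) UNIV"
    by (rule has_sum_line[of _ "\<lambda>m. (0, m)"]) (use b in \<open>auto intro: inj_onI simp: image_iff prod_eq_iff\<close>)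
  have 3: "((\<lambda>z. if fst z = snd z then c (fst z) * (x powi fst z * y powi snd z) else 0) has_sum u) UNIV"
    by (rule has_sum_line[of _ "\<lambda>m. (m, m)"])
      (use c in \<open>auto intro: inj_onI simp: image_iff prod_eq_iff power_int_mult_distrib\<close>)
  show ?thesis
    by (rule has_sum_cong[THEN iffD1, OF _ has_sum_add[OF has_sum_add[OF 1 2] 3]])
      (simp add: case_prod_unfold algebra_simps)
qed

end

context
  fixes p x y :: real
  assumes p: "0 < p" "p < 1" and x: "p < x" "x < 1" and y: "p < y" "y < 1" and xy: "p < x * y"
begin

lemma xy_bounds: "0 < x" "0 < y" "x * y < 1"
  using p x y mult_strict_mono[of x 1 y 1] by auto

text \<open>The sum of \<open>lc_bilinear\<close> over the lattice. It plays the role of the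
  Frobenius-Stickelberger relation between zeta values at three points of sum 0; p < x y keeps the
  third point in the domain of convergence.\<close>

lemma Zs_bilinear: "Zs p x * Zs p y - Zs p (x * y) * (Zs p x + Zs p y) = - (Ws p x + Ws p y + Ws p (x * y))"
proof (rule has_sum_unique)
  note pos = xy_bounds(1,2) and xy' = xy xy_bounds(3)
  have "((\<lambda>z. (case z of (M, N) \<Rightarrow> lc p M * lc p N * (x powi M * y powi N)) -
      ((case z of (M, N) \<Rightarrow> lc p N * lc p (M - N) * (x powi M * y powi N)) +
       (case z of (M, N) \<Rightarrow> lc p M * lc p (N - M) * (x powi M * y powi N)))) has_sum
      (Zs p x * Zs p y - (Zs p (x * y) * Zs p x + Zs p (x * y) * Zs p y))) UNIV"
    by (intro has_sum_diff_real has_sum_add has_sum_product_lattice has_sum_product_lattice_left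
        has_sum_product_lattice_right Zs p x y xy' pos)
  then show "((\<lambda>(M, N). (lc p M * lc p N - lc p N * lc p (M - N) - lc p M * lc p (N - M)) *
      (x powi M * y powi N)) has_sum (Zs p x * Zs p y - Zs p (x * y) * (Zs p x + Zs p y))) UNIV"
    by (simp add: case_prod_unfold algebra_simps)
  show "((\<lambda>(M, N). (lc p M * lc p N - lc p N * lc p (M - N) - lc p M * lc p (N - M)) *
      (x powi M * y powi N)) has_sum (- (Ws p x + Ws p y + Ws p (x * y)))) UNIV"
    unfolding lc_bilinear[OF p]
    using has_sum_uminusI[OF has_sum_three_lines[OF pos Ws[OF p x] Ws[OF p y] Ws[OF p xy']]]
    by (simp only: case_prod_unfold mult_minus_left)
qed

text \<open>The previous relation under x d/dx with y fixed, obtained by weighting the coefficients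
  with M, which avoids differentiating the series. The Leibniz rule appears as M = N + (M -
  N).\<close>

lemma dZs_bilinear:
  "dZs p x * Zs p y - dZs p (x * y) * (Zs p x + Zs p y) - Zs p (x * y) * dZs p x = - (dWs p x + dWs p (x * y))"
proof (rule has_sum_unique)
  note pos = xy_bounds(1,2) and xy' = xy xy_bounds(3)
  have "((\<lambda>z. (case z of (M, N) \<Rightarrow> (of_int M * lc p M) * lc p N * (x powi M * y powi N)) -
      ((case z of (M, N) \<Rightarrow> (of_int N * lc p N) * lc p (M - N) * (x powi M * y powi N)) +
       (case z of (M, N) \<Rightarrow> lc p N * (of_int (M - N) * lc p (M - N)) * (x powi M * y powi N)) +
       (case z of (M, N) \<Rightarrow> (of_int M * lc p M) * lc p (N - M) * (x powi M * y powi N)))) has_sum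
      (dZs p x * Zs p y - (dZs p (x * y) * Zs p x + Zs p (x * y) * dZs p x + dZs p (x * y) * Zs p y))) UNIV"
    by (intro has_sum_diff_real has_sum_add has_sum_product_lattice[OF pos] has_sum_product_lattice_left[OF pos]
        has_sum_product_lattice_right[OF pos] Zs dZs p x y xy')
  then show "((\<lambda>(M, N). of_int M * (lc p M * lc p N - lc p N * lc p (M - N) - lc p M * lc p (N - M)) *
      (x powi M * y powi N)) has_sum (dZs p x * Zs p y - dZs p (x * y) * (Zs p x + Zs p y) - Zs p (x * y) * dZs p x)) UNIV"
    by (simp add: case_prod_unfold algebra_simps)
  \<comment> \<open>On the line M = 0 the weight M vanishes, hence a zero series in the slot for
    y.\<close>
  have "((\<lambda>m. 0 * y powi m) has_sum 0) UNIV" by simp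
  note lines = has_sum_uminusI[OF has_sum_three_lines[OF pos dWs[OF p x] this dWs[OF p xy']]]
  show "((\<lambda>(M, N). of_int M * (lc p M * lc p N - lc p N * lc p (M - N) - lc p M * lc p (N - M)) *
      (x powi M * y powi N)) has_sum (- (dWs p x + dWs p (x * y)))) UNIV"
    unfolding lc_bilinear[OF p]
    by (rule has_sum_cong[THEN iffD1, OF _ lines[unfolded add_0_right]]) (auto simp: case_prod_unfold)
qed

end

text \<open>\<open>lc\<close> rises from 0 to 1 along the integers, so a shift by n changes the
  total by n. The step function \<open>u\<close>, with the same half value at 0, carries this
  change; the difference \<open>r\<close> is absolutely summable and its shift cancels.\<close>

lemma has_sum_telescope_int:
  assumes p: "0 < p" "p < 1"
  shows "((\<lambda>m. lc p m - lc p (m - n)) has_sum of_int n) UNIV"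
proof -
  define u :: "int \<Rightarrow> real" where "u m = (if m > 0 then 1 else if m = 0 then 1/2 else 0)" for m
  define r where "r m = lc p m - u m" for m
  have r_bound: "\<bar>r m\<bar> \<le> 1 / (1 - p) * p ^ nat \<bar>m\<bar>" for m
  proof (cases "m = 0")
    case False
    have "\<bar>r m\<bar> = \<bar>lc p (- \<bar>m\<bar>)\<bar>" using False lc_minus[OF p, of m] by (auto simp: r_def u_def abs_if)
    then show ?thesis using lc_bound[OF p, of "- \<bar>m\<bar>"] False by simp
  qed (use p in \<open>simp add: r_def u_def lc_def\<close>)
  have "r summable_on UNIV"
  proof (rule summable_on_int_bound)
    fix m
    have "1 / (1 - p) * 1 * p ^ nat \<bar>m\<bar> \<le> 1 / (1 - p) * (1 + real (nat \<bar>m\<bar>)) * p ^ nat \<bar>m\<bar>"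
      by (intro mult_right_mono mult_left_mono) (use p in auto)
    then show "\<bar>r m\<bar> \<le> 1 / (1 - p) * (1 + real (nat \<bar>m\<bar>)) * p ^ nat \<bar>m\<bar>" using r_bound[of m] by simp
  qed (use p in auto)
  then have r: "(r has_sum infsum r UNIV) UNIV" by (rule has_sum_infsum)
  have shift: "((\<lambda>m. f (m - k)) has_sum s) UNIV \<longleftrightarrow> (f has_sum s) UNIV" for f :: "int \<Rightarrow> real" and k s
    by (rule has_sum_reindex_bij_witness[of _ "\<lambda>m. m + k" "\<lambda>m. m - k"]) auto
  have r': "((\<lambda>m. r m - r (m - n)) has_sum 0) UNIV"
    using has_sum_diff_real[OF r shift[THEN iffD2, OF r]] by simp
  have u_nat: "((\<lambda>m. u m - u (m - int k)) has_sum real k) UNIV" for k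
  proof (induction k)
    case (Suc k)
    have "((\<lambda>m. u m - u (m - 1)) has_sum 1) UNIV"
      by (rule has_sum_finite_neutralI[of "{0, 1}"]) (auto simp: u_def)
    then have "((\<lambda>m. u (m - int k) - u (m - int k - 1)) has_sum 1) UNIV"
      using shift[of "\<lambda>m. u m - u (m - 1)" "int k" 1] by simp
    from has_sum_add[OF Suc this] show ?case by (simp add: algebra_simps)
  qed simp
  have u': "((\<lambda>m. u m - u (m - n)) has_sum of_int n) UNIV"
  proof (cases "n \<ge> 0")
    case True
    then show ?thesis using u_nat[of "nat n"] by simp
  next
    case False
    have "((\<lambda>m. u (m - n) - u (m - n - int (nat (- n)))) has_sum real (nat (- n))) UNIV"
      using shift[of "\<lambda>m. u m - u (m - int (nat (- n)))" n] u_nat[of "nat (- n)"] by simp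
    from has_sum_uminusI[OF this] show ?thesis using False by simp
  qed
  show ?thesis using has_sum_add[OF r' u'] by (simp add: r_def)
qed

text \<open>The coefficient of x^n in the square is summed by the telescope: the shift contributes
  \<open>of_int n * lc p n\<close> and the two corrections contribute
  \<open>2 * ld p n\<close>.\<close>

lemma Zs_square:
  assumes p: "0 < p" "p < 1" and x: "p < x" "x < 1" and k: "(ld p has_sum k) UNIV"
  shows "(Zs p x)\<^sup>2 = dZs p x + 2 * Ws p x + k"
proof -
  have x0: "0 < x" using p x by linarith
  have "((\<lambda>(m, k). lc p m * x powi m * (lc p k * x powi k)) has_sum Zs p x * Zs p x) UNIV"
    using has_sum_Times_mult[OF Zs[OF p x] Zs[OF p x]] by simp
  then have sum1: "((\<lambda>(n, m). lc p m * lc p (n - m) * x powi n) has_sum Zs p x * Zs p x) (UNIV \<times> UNIV)"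
  proof (rule has_sum_reindex_bij_witness[where i = "\<lambda>(n, m). (m, n - m)" and j = "\<lambda>(m, k). (m + k, m)", THEN iffD1, rotated -1])
    show "(case (case z of (m, k) \<Rightarrow> (m + k, m)) of (n, m) \<Rightarrow> lc p m * lc p (n - m) * x powi n) =
        (case z of (m, k) \<Rightarrow> lc p m * x powi m * (lc p k * x powi k))" for z
      using x0 by (simp add: case_prod_unfold power_int_add)
  qed (auto simp: case_prod_unfold)
  have sum2: "((\<lambda>m. lc p m * lc p (n - m)) has_sum (of_int n * lc p n + 2 * ld p n + (if n = 0 then k else 0))) UNIV" for n
  proof (cases "n = 0")
    \<comment> \<open>The extra 1/6 in \<open>lc_convolution_0\<close> is exactly
      \<open>2 * ld p 0\<close>, so only the total \<open>k\<close> is left over.\<close>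
    case True
    then show ?thesis
      using has_sum_add[OF k has_sum_single_int[of 0 "1/6"]]
      by (simp add: lc_convolution_0[OF p]) (simp add: ld_def add.commute)
  next
    case False
    show ?thesis
      using has_sum_add[OF has_sum_add[OF has_sum_cmult_right[OF has_sum_telescope_int[OF p, of n], of "lc p n"]
          has_sum_single_int[of 0 "ld p n"]] has_sum_single_int[of n "ld p n"]] False
      unfolding lc_convolution[OF p False] by (simp add: mult_ac add_ac)
  qed
  have "((\<lambda>n. (of_int n * lc p n + 2 * ld p n + (if n = 0 then k else 0)) * x powi n) has_sum Zs p x * Zs p x) UNIV"
    by (rule has_sum_SigmaD[OF sum1]) (use has_sum_cmult_left[OF sum2] in simp)
  moreover have "((\<lambda>n. (of_int n * lc p n + 2 * ld p n + (if n = 0 then k else 0)) * x powi n) has_sum dZs p x + 2 * Ws p x + k) UNIV"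
    by (rule has_sum_cong[THEN iffD1, OF _ has_sum_add[OF has_sum_add[OF dZs[OF p x] has_sum_cmult_right[OF Ws[OF p x], of 2]] has_sum_single_int[of 0 k]]])
      (simp add: algebra_simps)
  ultimately show ?thesis
    using has_sum_unique by (simp add: power2_eq_square)
qed

subsection \<open>Lambert series in the nome\<close>

text \<open>The exponent c is 1 for \<open>Zs\<close> and 2 for \<open>Ws\<close>, and k = 1 marks
  their derivatives; b selects the residue class modulo 5.\<close>

definition LS :: "nat \<Rightarrow> nat \<Rightarrow> nat \<Rightarrow> real \<Rightarrow> real" where
  "LS k c b q = (\<Sum>n. real (Suc n) ^ k * (q ^ Suc n) ^ b / (1 - (q ^ Suc n) ^ 5) ^ c)"

lemma power5_gap:
  fixes q :: real
  assumes "0 < q" "q < 1"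
  shows "1 - q \<le> 1 - (q ^ Suc n) ^ 5" "(q ^ Suc n) ^ 5 < 1"
proof -
  have "(q ^ Suc n) ^ 5 = q ^ (Suc n * 5)" by (simp only: power_mult)
  also have "\<dots> \<le> q ^ 1" by (rule power_decreasing) (use assms in auto)
  finally show "1 - q \<le> 1 - (q ^ Suc n) ^ 5" by simp
  then show "(q ^ Suc n) ^ 5 < 1" using assms by linarith
qed

lemma summable_nat_power:
  fixes q :: real
  assumes "0 < q" "q < 1" "k \<le> 1"
  shows "summable (\<lambda>n. real (Suc n) ^ k * q ^ n)"
proof -
  have "summable (\<lambda>n. real (Suc n) * q ^ n)"
    using assms termdiff_converges[of q 1 "\<lambda>_. 1"] by (auto simp: diffs_def summable_geometric)
  then show ?thesis using assms by (cases k) (auto intro: summable_geometric)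
qed

lemma LS_term_nonneg:
  fixes q :: real
  assumes "0 < q" "q < 1"
  shows "0 \<le> real (Suc n) ^ k * (q ^ Suc n) ^ b / (1 - (q ^ Suc n) ^ 5) ^ c"
  using assms power5_gap[OF assms, of n] by (intro divide_nonneg_nonneg mult_nonneg_nonneg zero_le_power) linarith+

lemma LS_sums:
  assumes q: "0 < q" "q < 1" and "0 < b" "k \<le> 1"
  shows "(\<lambda>n. real (Suc n) ^ k * (q ^ Suc n) ^ b / (1 - (q ^ Suc n) ^ 5) ^ c) sums LS k c b q"
  unfolding LS_def
proof (rule summable_sums, rule summable_comparison_test')
  show "summable (\<lambda>n. 1 / (1 - q) ^ c * (real (Suc n) ^ k * q ^ n))"
    by (intro summable_mult summable_nat_power assms)
  fix n :: nat
  have "(q ^ Suc n) ^ b = q ^ (Suc n * b)" by (simp only: power_mult)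
  also have "\<dots> \<le> q ^ n" by (rule power_decreasing) (use assms in \<open>auto simp: Suc_leI trans_le_add2\<close>)
  finally have "real (Suc n) ^ k * (q ^ Suc n) ^ b / (1 - (q ^ Suc n) ^ 5) ^ c \<le> real (Suc n) ^ k * q ^ n / (1 - q) ^ c"
    using power5_gap[OF q, of n] q by (intro frac_le mult_left_mono power_mono) auto
  then show "norm (real (Suc n) ^ k * (q ^ Suc n) ^ b / (1 - (q ^ Suc n) ^ 5) ^ c) \<le> 1 / (1 - q) ^ c * (real (Suc n) ^ k * q ^ n)"
    using LS_term_nonneg[OF q, of n k b c] by simp
qed

lemma LS_has_sum:
  assumes q: "0 < q" "q < 1" and "0 < b" "k \<le> 1"
  shows "((\<lambda>n. real (Suc n) ^ k * (q ^ Suc n) ^ b / (1 - (q ^ Suc n) ^ 5) ^ c) has_sum LS k c b q) UNIV"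
  using LS_sums[OF assms, of c]
  by (intro norm_summable_imp_has_sum) (simp_all only: real_norm_def abs_of_nonneg[OF LS_term_nonneg[OF q]] sums_iff)

lemma LS_1_eq:
  assumes q: "0 < q" "q < 1" and b: "0 < b" "k \<le> 1"
  shows "LS k 1 b q = LS k 2 b q - LS k 2 (b + 5) q"
proof (rule sums_unique2[OF LS_sums[OF assms]])
  have "real (Suc n) ^ k * (q ^ Suc n) ^ b / (1 - (q ^ Suc n) ^ 5) ^ 2 - real (Suc n) ^ k * (q ^ Suc n) ^ (b + 5) / (1 - (q ^ Suc n) ^ 5) ^ 2
    = real (Suc n) ^ k * (q ^ Suc n) ^ b / (1 - (q ^ Suc n) ^ 5) ^ 1" for n
  proof -
    define t where "t = q ^ Suc n"
    have "1 - t ^ 5 \<noteq> 0" using power5_gap[OF q, of n] by (simp add: t_def)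
    then show ?thesis unfolding t_def[symmetric] by (simp add: divide_simps power2_eq_square) (simp add: algebra_simps power_add)
  qed
  then show "(\<lambda>n. real (Suc n) ^ k * (q ^ Suc n) ^ b / (1 - (q ^ Suc n) ^ 5) ^ 1) sums (LS k 2 b q - LS k 2 (b + 5) q)"
    using sums_diff[OF LS_sums[OF q b, where c = 2] LS_sums[OF q, of "b + 5" k 2]] b by simp
qed

text \<open>With t = q^n, the negative half uses x^(-n) = t^(5-a) / t^5. The coefficients of
  negative index carry a factor t^5 that cancels this denominator, which leaves ordinary Lambert
  series.\<close>

lemma bilateral_eq_LS:
  assumes q: "0 < q" "q < 1" and a: "0 < a" "a < 5"
  shows "Zs (q ^ 5) (q ^ a) = 1/2 + LS 0 1 a q - LS 0 1 (5 - a) q"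
    and "dZs (q ^ 5) (q ^ a) = LS 1 1 a q + LS 1 1 (5 - a) q"
    and "Ws (q ^ 5) (q ^ a) = 1/12 - LS 0 2 (a + 5) q - LS 0 2 (5 - a) q"
    and "dWs (q ^ 5) (q ^ a) = LS 1 2 (5 - a) q - LS 1 2 (a + 5) q"
    and "(ld (q ^ 5) has_sum (1/12 - 2 * LS 0 2 5 q)) UNIV"
proof -
  have p: "0 < q ^ 5" "q ^ 5 < 1" using q power_less_one_iff[of q 5] by auto
  have x: "q ^ 5 < q ^ a" "q ^ a < 1"
    using q a power_strict_decreasing[of a 5 q] power_less_one_iff[of q a] by auto
  have b: "0 < 5 - a" "0 < a + 5" using a by auto
  define t where "t n = q ^ Suc n" for n
  have t: "0 < t n" "t n ^ 5 < 1" for n using q power5_gap[OF q, of n] by (auto simp: t_def)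
  define u where "u n = (q ^ a) powi n" for n
  have xp: "u (int (Suc n)) = t n ^ a" for n
    by (simp only: u_def power_int_of_nat t_def power_mult[symmetric] mult.commute)
  have pp: "(q ^ 5) powi int (Suc n) = t n ^ 5" for n
    by (simp only: power_int_of_nat t_def power_mult[symmetric] mult.commute)
  have xn: "u (- int (Suc n)) = t n ^ (5 - a) / t n ^ 5" for n
  proof -
    have "t n ^ 5 = t n ^ (5 - a) * t n ^ a" using a by (simp flip: power_add)
    then show ?thesis using xp[of n] unfolding u_def power_int_minus using t[of n] by (simp add: field_simps)
  qed
  have lp: "lc (q ^ 5) (int (Suc n)) = 1 / (1 - t n ^ 5)" for n
    unfolding lc_def pp by simp
  have ln: "lc (q ^ 5) (- int (Suc n)) = - (t n ^ 5) / (1 - t n ^ 5)" for n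
    unfolding lc_minus[OF p] lp using t[of n] by (simp add: field_simps)
  have dp: "ld (q ^ 5) (int (Suc n)) = - (t n ^ 5) / (1 - t n ^ 5)\<^sup>2" for n
    unfolding ld_def lp ln by (simp add: power2_eq_square)
  have dn: "ld (q ^ 5) (- int (Suc n)) = - (t n ^ 5) / (1 - t n ^ 5)\<^sup>2" for n
    unfolding ld_minus[OF p] dp ..
  have zero: "lc (q ^ 5) 0 = 1/2" "ld (q ^ 5) 0 = 1/12" "u 0 = 1" by (simp_all add: lc_def ld_def u_def)
  have t0: "t n \<noteq> 0" for n using t(1)[of n] by simp
  have S: "((\<lambda>n. real (Suc n) ^ k * t n ^ b / (1 - t n ^ 5) ^ c) has_sum LS k c b q) UNIV"
    if "0 < b" "k \<le> 1" for k b c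
    using LS_has_sum[OF q that] by (simp only: t_def)
  have "((\<lambda>n. lc (q ^ 5) n * u n) has_sum (1/2 + LS 0 1 a q + (- LS 0 1 (5 - a) q))) UNIV"
    using has_sum_int_split[of "\<lambda>n. lc (q ^ 5) n * u n" "LS 0 1 a q" "- LS 0 1 (5 - a) q"]
      S[OF a(1), of 0 1] has_sum_uminusI[OF S[OF b(1), of 0 1]]
    by (simp add: xp xn lp ln t0 zero del: of_nat_Suc)
  then show "Zs (q ^ 5) (q ^ a) = 1/2 + LS 0 1 a q - LS 0 1 (5 - a) q"
    using has_sum_unique[OF Zs[OF p x, folded u_def]] by simp
  have "((\<lambda>n. of_int n * lc (q ^ 5) n * u n) has_sum (0 + LS 1 1 a q + LS 1 1 (5 - a) q)) UNIV"
    using has_sum_int_split[of "\<lambda>n. of_int n * lc (q ^ 5) n * u n" "LS 1 1 a q" "LS 1 1 (5 - a) q"]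
      S[OF a(1), of 1 1] S[OF b(1), of 1 1]
    by (simp add: xp xn lp ln t0 del: of_nat_Suc)
  then show "dZs (q ^ 5) (q ^ a) = LS 1 1 a q + LS 1 1 (5 - a) q"
    using has_sum_unique[OF dZs[OF p x, folded u_def]] by simp
  have "((\<lambda>n. ld (q ^ 5) n * u n) has_sum (1/12 + (- LS 0 2 (a + 5) q) + (- LS 0 2 (5 - a) q))) UNIV"
    using has_sum_int_split[of "\<lambda>n. ld (q ^ 5) n * u n" "- LS 0 2 (a + 5) q" "- LS 0 2 (5 - a) q"]
      has_sum_uminusI[OF S[OF b(2), of 0 2]] has_sum_uminusI[OF S[OF b(1), of 0 2]]
    by (simp add: xp xn dp dn t0 power_add mult_ac zero del: of_nat_Suc)
  then show "Ws (q ^ 5) (q ^ a) = 1/12 - LS 0 2 (a + 5) q - LS 0 2 (5 - a) q"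
    using has_sum_unique[OF Ws[OF p x, folded u_def]] by simp
  have "((\<lambda>n. of_int n * ld (q ^ 5) n * u n) has_sum (0 + (- LS 1 2 (a + 5) q) + LS 1 2 (5 - a) q)) UNIV"
    using has_sum_int_split[of "\<lambda>n. of_int n * ld (q ^ 5) n * u n" "- LS 1 2 (a + 5) q" "LS 1 2 (5 - a) q"]
      has_sum_uminusI[OF S[OF b(2), of 1 2]] S[OF b(1), of 1 2]
    by (simp add: xp xn dp dn t0 power_add mult_ac del: of_nat_Suc)
  then show "dWs (q ^ 5) (q ^ a) = LS 1 2 (5 - a) q - LS 1 2 (a + 5) q"
    using has_sum_unique[OF dWs[OF p x, folded u_def]] by simp
  have "(ld (q ^ 5) has_sum (1/12 + (- LS 0 2 5 q) + (- LS 0 2 5 q))) UNIV"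
    using has_sum_int_split[of "ld (q ^ 5)" "- LS 0 2 5 q" "- LS 0 2 5 q"] has_sum_uminusI[OF S[of 5 0 2]]
    by (simp add: dp dn zero del: of_nat_Suc)
  then show "(ld (q ^ 5) has_sum (1/12 - 2 * LS 0 2 5 q)) UNIV" by simp
qed

text \<open>Bounded weights let a single termwise differentiation serve the Lambert series, with
  weight 1, and the logarithms of the products, with weight \<open>1 / real (Suc n)\<close>.\<close>

lemma DERIV_lambert:
  assumes q: "0 < q" "q < 1" and b: "0 < b" and w: "\<And>n. \<bar>w n\<bar> \<le> 1"
  shows "((\<lambda>q. \<Sum>n. w n * ((q ^ Suc n) ^ b / (1 - (q ^ Suc n) ^ 5))) has_real_derivative
    (\<Sum>n. w n * (real b * (real (Suc n) * (q ^ Suc n) ^ b / (1 - (q ^ Suc n) ^ 5)) +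
       5 * (real (Suc n) * (q ^ Suc n) ^ (b + 5) / (1 - (q ^ Suc n) ^ 5)\<^sup>2))) / q) (at q)"
proof -
  \<comment> \<open>The midpoint between q and 1: on (0, s), which contains q in its interior, all
    denominators stay at least 1 - s, as the Weierstrass test requires.\<close>
  define s where "s = (1 + q) / 2"
  have s: "q < s" "0 < s" "s < 1" using q by (auto simp: s_def)
  define f where "f n x = w n * ((x ^ Suc n) ^ b / (1 - (x ^ Suc n) ^ 5))" for n and x :: real
  define f' where "f' n x = w n * (real b * (real (Suc n) * (x ^ Suc n) ^ b / (1 - (x ^ Suc n) ^ 5)) +
       5 * (real (Suc n) * (x ^ Suc n) ^ (b + 5) / (1 - (x ^ Suc n) ^ 5)\<^sup>2)) / x" for n and x :: real
  have deriv: "(f n has_field_derivative f' n x) (at x within {0<..<s})" if "x \<in> {0<..<s}" for n x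
  proof -
    have x: "0 < x" "x < 1" using that s by auto
    define t where "t = x ^ Suc n"
    have t: "0 < t" "t ^ 5 \<noteq> 1" using x power5_gap(2)[OF x, of n] by (auto simp: t_def)
    obtain c where c: "b = Suc c" using b gr0_implies_Suc by blast
    have 1: "((\<lambda>x. x ^ Suc n) has_field_derivative (real (Suc n) * t / x)) (at x within {0<..<s})"
      using DERIV_pow[of "Suc n" x "{0<..<s}"] x by (simp add: t_def)
    have 2: "((\<lambda>t. w n * (t ^ b / (1 - t ^ 5))) has_field_derivative
        w n * (real b * t ^ c / (1 - t ^ 5) + 5 * t ^ (b + 4) / (1 - t ^ 5)\<^sup>2)) (at t)"
    proof -
      have 3: "((\<lambda>t. t ^ b) has_field_derivative real b * t ^ c) (at t)"
        using DERIV_pow[of b t UNIV] c by simp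
      have 4: "((\<lambda>t. 1 - t ^ 5) has_field_derivative - (5 * t ^ 4)) (at t)"
        by (auto intro!: derivative_eq_intros)
      have nz: "1 - t ^ 5 \<noteq> 0" using t by simp
      have "(real b * t ^ c * (1 - t ^ 5) - t ^ b * - (5 * t ^ 4)) / ((1 - t ^ 5) * (1 - t ^ 5)) =
          real b * t ^ c / (1 - t ^ 5) + 5 * t ^ (b + 4) / (1 - t ^ 5)\<^sup>2"
        using nz by (simp add: power2_eq_square add_divide_distrib power_add)
      then show ?thesis using DERIV_cmult[OF DERIV_divide[OF 3 4 nz], of "w n"] by simp
    qed
    from DERIV_chain2[OF 2[unfolded t_def] 1[unfolded t_def]]
    show ?thesis unfolding f_def f'_def
      by (rule DERIV_cong) (use x in \<open>simp add: t_def[symmetric] c power_add eval_nat_numeral field_simps\<close>)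
  qed
  have bound: "norm (f' n x) \<le> (real b + 5) / (1 - s)\<^sup>2 * (real (Suc n) * s ^ n)" if "x \<in> {0<..<s}" for n x
  proof -
    have x: "0 < x" "x < 1" "x \<le> s" using that s by auto
    define t where "t = x ^ Suc n"
    have t: "0 < t" "t \<le> 1" "1 - s \<le> 1 - t ^ 5" "0 < 1 - t ^ 5"
      using x power5_gap[OF x(1,2), of n] by (auto simp: t_def power_le_one simp del: power_Suc)
    have sq: "(1 - s)\<^sup>2 \<le> (1 - t ^ 5)\<^sup>2" using t s by (intro power_mono) auto
    have "(1 - s)\<^sup>2 \<le> 1 - s" using s by (simp add: power2_eq_square mult_left_le)
    then have lin: "(1 - s)\<^sup>2 \<le> 1 - t ^ 5" using t by linarith
    have tb: "t ^ b \<le> t" using power_decreasing[of 1 b t] t b by simp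
    have tb5: "t ^ (b + 5) \<le> t" using power_decreasing[of 1 "b + 5" t] t by simp
    have sx: "t / x \<le> s ^ n" using x by (simp add: t_def power_mono)
    have A: "real (Suc n) * t ^ b / (1 - t ^ 5) \<le> real (Suc n) * t / (1 - s)\<^sup>2"
      by (intro frac_le mult_left_mono tb lin) (use t s in auto)
    have B: "real (Suc n) * t ^ (b + 5) / (1 - t ^ 5)\<^sup>2 \<le> real (Suc n) * t / (1 - s)\<^sup>2"
      by (intro frac_le mult_left_mono tb5 sq) (use t s in auto)
    define g where "g = real b * (real (Suc n) * t ^ b / (1 - t ^ 5)) + 5 * (real (Suc n) * t ^ (b + 5) / (1 - t ^ 5)\<^sup>2)"
    have g0: "0 \<le> g" unfolding g_def using t by (intro add_nonneg_nonneg mult_nonneg_nonneg divide_nonneg_nonneg) auto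
    have "g \<le> real b * (real (Suc n) * t / (1 - s)\<^sup>2) + 5 * (real (Suc n) * t / (1 - s)\<^sup>2)"
      unfolding g_def by (intro add_mono mult_left_mono A B) auto
    also have "\<dots> = (real b + 5) / (1 - s)\<^sup>2 * real (Suc n) * t" by (simp add: add_divide_distrib ring_distribs mult_ac)
    finally have "g / x \<le> (real b + 5) / (1 - s)\<^sup>2 * real (Suc n) * t / x"
      using x by (intro divide_right_mono) auto
    also have "\<dots> = (real b + 5) / (1 - s)\<^sup>2 * real (Suc n) * (t / x)" by simp
    also have "\<dots> \<le> (real b + 5) / (1 - s)\<^sup>2 * real (Suc n) * s ^ n"
      by (intro mult_left_mono sx) auto
    finally have gx: "g / x \<le> (real b + 5) / (1 - s)\<^sup>2 * (real (Suc n) * s ^ n)" by (simp only: mult.assoc)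
    have "norm (f' n x) = \<bar>w n\<bar> * (g / x)"
      using g0 x unfolding f'_def t_def[symmetric] g_def[symmetric] by (simp add: abs_mult)
    also have "\<dots> \<le> 1 * (g / x)" using g0 x by (intro mult_right_mono w) auto
    finally show ?thesis using gx by linarith
  qed
  have unif: "uniformly_convergent_on {0<..<s} (\<lambda>n x. \<Sum>i<n. f' i x)"
    by (rule Weierstrass_m_test'[OF bound summable_mult[OF summable_nat_power[OF s(2,3), of 1, unfolded power_one_right]]])
      auto
  have summ: "summable (\<lambda>n. f n q)"
  proof (rule summable_comparison_test')
    show "summable (\<lambda>n. real (Suc n) ^ 0 * (q ^ Suc n) ^ b / (1 - (q ^ Suc n) ^ 5) ^ 1)"
      using LS_sums[OF q b, of 0 1] by (simp add: sums_iff)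
    fix n
    define g where "g = (q ^ Suc n) ^ b / (1 - (q ^ Suc n) ^ 5)"
    have g: "0 \<le> g" using LS_term_nonneg[OF q, of n 0 b 1] by (simp add: g_def)
    then have "\<bar>w n\<bar> * g \<le> 1 * g" by (intro mult_right_mono w)
    then have "norm (f n q) \<le> g" using g unfolding f_def g_def[symmetric] by (simp add: abs_mult)
    then show "norm (f n q) \<le> real (Suc n) ^ 0 * (q ^ Suc n) ^ b / (1 - (q ^ Suc n) ^ 5) ^ 1"
      by (simp add: g_def)
  qed
  have q_in: "q \<in> interior {0<..<s}" "q \<in> {0<..<s}" using s q by (simp_all add: interior_open)
  have "((\<lambda>x. \<Sum>n. f n x) has_field_derivative (\<Sum>n. f' n q)) (at q)"
    by (rule has_field_derivative_series'(2)[OF _ deriv unif q_in(2) summ q_in(1)]) auto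
  moreover have "summable (\<lambda>n. f' n q)"
    by (rule summable_comparison_test'[OF summable_mult[OF summable_nat_power[OF s(2,3), of 1, unfolded power_one_right]], OF _ bound[OF q_in(2)]])
      simp
  then have "summable (\<lambda>n. f' n q * q)" by (rule summable_mult2)
  from suminf_divide[OF this, of q] have "(\<Sum>n. f' n q) = (\<Sum>n. f' n q * q) / q" using q by simp
  ultimately show ?thesis using q by (simp add: f_def f'_def)
qed

lemma DERIV_LS:
  assumes q: "0 < q" "q < 1" and b: "0 < b"
  shows "(LS 0 1 b has_real_derivative (real b * LS 1 1 b q + 5 * LS 1 2 (b + 5) q) / q) (at q)"
proof -
  have "(\<Sum>n. 1 * (real b * (real (Suc n) * (q ^ Suc n) ^ b / (1 - (q ^ Suc n) ^ 5)) +
       5 * (real (Suc n) * (q ^ Suc n) ^ (b + 5) / (1 - (q ^ Suc n) ^ 5)\<^sup>2))) = real b * LS 1 1 b q + 5 * LS 1 2 (b + 5) q"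
    using sums_add[OF sums_mult[OF LS_sums[OF q b, of 1 1], of "real b"] sums_mult[OF LS_sums[OF q, of "b + 5" 1 2], of 5]]
    by (simp add: sums_iff del: of_nat_Suc power_Suc)
  then show ?thesis
    using DERIV_lambert[OF q b, of "\<lambda>_. 1"] by (simp add: LS_def[abs_def] del: of_nat_Suc power_Suc)
qed

text \<open>Expanding \<open>ln (1 - q ^ (5 * k + b))\<close> and summing over \<open>k\<close> first.\<close>

lemma ln_qpoch_inf:
  assumes q: "0 < q" "q < 1" and b: "0 < b"
  shows "ln (qpoch_inf q 5 b) = - (\<Sum>n. 1 / real (Suc n) * ((q ^ Suc n) ^ b / (1 - (q ^ Suc n) ^ 5)))"
proof -
  define F where "F k n = (q ^ (5 * k + b)) ^ Suc n / real (Suc n)" for k n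
  have x: "0 < q ^ (5 * k + b)" "q ^ (5 * k + b) < 1" for k
    using q b power_less_one_iff[of q "5 * k + b"] by auto
  have row: "((\<lambda>n. F k n) has_sum - ln (1 - q ^ (5 * k + b))) UNIV" for k
  proof (rule sums_nonneg_imp_has_sum)
    have "(\<lambda>n. (q ^ (5 * k + b)) ^ Suc n / real (Suc n)) sums - ln (1 - q ^ (5 * k + b))"
    proof -
      have "(\<lambda>n. - ((q ^ (5 * k + b)) ^ n / real n)) sums ln (1 - q ^ (5 * k + b))"
        using ln_series'[of "- (q ^ (5 * k + b))"] x[of k] by simp
      from sums_minus[OF this] show ?thesis
        by (subst sums_Suc_iff) simp
    qed
    then show "F k sums - ln (1 - q ^ (5 * k + b))" by (simp add: F_def[abs_def])
    show "0 \<le> F k n" for n using q by (simp add: F_def)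
  qed
  have col: "((\<lambda>k. F k n) has_sum 1 / real (Suc n) * ((q ^ Suc n) ^ b / (1 - (q ^ Suc n) ^ 5))) UNIV" for n
  proof (rule sums_nonneg_imp_has_sum)
    have e: "F k n = 1 / real (Suc n) * (q ^ Suc n) ^ b * ((q ^ Suc n) ^ 5) ^ k" for k
      unfolding F_def power_mult[symmetric] power_add[symmetric] by (simp add: power_add[symmetric] algebra_simps)
    have "(\<lambda>k. 1 / real (Suc n) * (q ^ Suc n) ^ b * ((q ^ Suc n) ^ 5) ^ k) sums (1 / real (Suc n) * (q ^ Suc n) ^ b * (1 / (1 - (q ^ Suc n) ^ 5)))"
      by (intro sums_mult geometric_sums) (use power5_gap(2)[OF q, of n] q in auto)
    then show "(\<lambda>k. F k n) sums (1 / real (Suc n) * ((q ^ Suc n) ^ b / (1 - (q ^ Suc n) ^ 5)))"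
      by (simp add: e del: of_nat_Suc power_Suc)
    show "0 \<le> F k n" for k using q by (simp add: F_def)
  qed
  have "(\<lambda>k. - ln (1 - q ^ (5 * k + b))) sums - ln (qpoch_inf q 5 b)"
    by (intro sums_minus has_prod_imp_sums_ln_real' qpoch_inf_has_prod q b) (use x in auto)
  then have rows: "((\<lambda>k. - ln (1 - q ^ (5 * k + b))) has_sum - ln (qpoch_inf q 5 b)) UNIV"
    by (rule sums_nonneg_imp_has_sum) (use x in \<open>auto simp: less_imp_le\<close>)
  have "(\<lambda>(k, n). F k n) summable_on UNIV \<times> UNIV"
    by (rule summable_on_SigmaI[OF _ has_sum_imp_summable[OF rows]]) (use row q in \<open>auto simp: F_def\<close>)
  then have "((\<lambda>(k, n). F k n) has_sum - ln (qpoch_inf q 5 b)) (UNIV \<times> UNIV)"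
    by (intro has_sum_SigmaI[where g = "\<lambda>k. - ln (1 - q ^ (5 * k + b))"]) (use row rows in auto)
  then have "((\<lambda>(n, k). F k n) has_sum - ln (qpoch_inf q 5 b)) (UNIV \<times> UNIV)"
    by (subst has_sum_swap) simp
  then have "((\<lambda>n. 1 / real (Suc n) * ((q ^ Suc n) ^ b / (1 - (q ^ Suc n) ^ 5))) has_sum - ln (qpoch_inf q 5 b)) UNIV"
    by (rule has_sum_SigmaD) (use col in auto)
  from has_sum_imp_sums[OF this] show ?thesis by (simp add: sums_iff)
qed

lemma DERIV_ln_qpoch_inf:
  assumes q: "0 < q" "q < 1" and b: "0 < b"
  shows "((\<lambda>q. ln (qpoch_inf q 5 b)) has_real_derivative - ((real b * LS 0 1 b q + 5 * LS 0 2 (b + 5) q) / q)) (at q)"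
proof -
  have "(\<Sum>n. 1 / real (Suc n) * (real b * (real (Suc n) * (q ^ Suc n) ^ b / (1 - (q ^ Suc n) ^ 5)) +
       5 * (real (Suc n) * (q ^ Suc n) ^ (b + 5) / (1 - (q ^ Suc n) ^ 5)\<^sup>2))) = real b * LS 0 1 b q + 5 * LS 0 2 (b + 5) q"
    using sums_add[OF sums_mult[OF LS_sums[OF q b, of 0 1], of "real b"] sums_mult[OF LS_sums[OF q, of "b + 5" 0 2], of 5]]
    by (simp add: sums_iff distrib_left del: of_nat_Suc power_Suc)
  then have "((\<lambda>q. - (\<Sum>n. 1 / real (Suc n) * ((q ^ Suc n) ^ b / (1 - (q ^ Suc n) ^ 5)))) has_real_derivative
      - ((real b * LS 0 1 b q + 5 * LS 0 2 (b + 5) q) / q)) (at q)"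
    using DERIV_minus[OF DERIV_lambert[OF q b, of "\<lambda>n. 1 / real (Suc n)"]] by simp
  moreover have "\<forall>\<^sub>F x in nhds q. - (\<Sum>n. 1 / real (Suc n) * ((x ^ Suc n) ^ b / (1 - (x ^ Suc n) ^ 5))) = ln (qpoch_inf x 5 b)"
    using eventually_nhds_in_open[of "{0<..<1}" q] q
    by (auto elim!: eventually_mono simp: ln_qpoch_inf[OF _ _ b] simp del: of_nat_Suc power_Suc)
  ultimately show ?thesis
    by (subst DERIV_cong_ev[OF refl _ refl, symmetric]) auto
qed

subsection \<open>Differential equations for the Rogers--Ramanujan products\<close>

text \<open>The addition relations are taken at (q, q) and (q, q^2). Their third points are q^2 and
  q^3, and the latter is reflected to q^2, so only values at q and q^2 occur.\<close>

lemma bilateral_relations: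
  fixes q :: real
  assumes q: "0 < q" "q < 1"
  defines "z a \<equiv> 1/2 + LS 0 1 a q - LS 0 1 (5 - a) q"
    and "w a \<equiv> 1/12 - LS 0 2 (a + 5) q - LS 0 2 (5 - a) q"
    and "z' a \<equiv> LS 1 1 a q + LS 1 1 (5 - a) q"
    and "w' a \<equiv> LS 1 2 (5 - a) q - LS 1 2 (a + 5) q"
  shows "z 1 * z 1 - z 2 * (z 1 + z 1) = - (w 1 + w 1 + w 2)"
    and "z 1 * z 2 - (1 - z 2) * (z 1 + z 2) = - (w 1 + w 2 + (w 2 - z 2 + 1/2))"
    and "z' 1 * z 1 - z' 2 * (z 1 + z 1) - z 2 * z' 1 = - (w' 1 + w' 2)"
    and "z' 1 * z 2 - z' 2 * (z 1 + z 2) - (1 - z 2) * z' 1 = - (w' 1 + (z' 2 - w' 2))"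
    and "(z 1)\<^sup>2 = z' 1 + 2 * w 1 + (1/12 - 2 * LS 0 2 5 q)"
    and "(z 2)\<^sup>2 = z' 2 + 2 * w 2 + (1/12 - 2 * LS 0 2 5 q)"
proof -
  have p: "0 < q ^ 5" "q ^ 5 < 1" using q power_less_one_iff[of q 5] by auto
  have x: "q ^ 5 < q ^ a" "q ^ a < 1" if "0 < a" "a < 5" for a
    using q that power_strict_decreasing[of a 5 q] power_less_one_iff[of q a] by auto
  have z: "Zs (q ^ 5) (q ^ a) = z a" "dZs (q ^ 5) (q ^ a) = z' a" "Ws (q ^ 5) (q ^ a) = w a" "dWs (q ^ 5) (q ^ a) = w' a"
    if "a = 1 \<or> a = 2" for a
    using bilateral_eq_LS(1-4)[OF q, of a] that by (auto simp: z_def z'_def w_def w'_def)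
  have k: "(ld (q ^ 5) has_sum (1/12 - 2 * LS 0 2 5 q)) UNIV" using bilateral_eq_LS(5)[OF q, of 1] by simp
  have m: "q ^ 1 * q ^ 1 = q ^ 2" "q ^ 1 * q ^ 2 = q ^ 5 / q ^ 2" using q by (simp_all add: eval_nat_numeral)
  have x12: "q ^ 5 < q ^ 1 * q ^ 1" "q ^ 5 < q ^ 1 * q ^ 2"
    using x[of 2] x[of 3] by (simp_all add: eval_nat_numeral)
  have x1: "q ^ 5 < q ^ 1" "q ^ 1 < 1" and x2: "q ^ 5 < q ^ 2" "q ^ 2 < 1" using x[of 1] x[of 2] by auto
  note z12 = z[OF disjI1[OF refl]] z[OF disjI2[OF refl]]
  note reflect = Zs_reflect[OF p x2] Ws_reflect[OF p x2] dZs_reflect[OF p x2] dWs_reflect[OF p x2]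
  show "z 1 * z 1 - z 2 * (z 1 + z 1) = - (w 1 + w 1 + w 2)"
    using Zs_bilinear[OF p x1 x1 x12(1)] unfolding m z12 .
  show "z 1 * z 2 - (1 - z 2) * (z 1 + z 2) = - (w 1 + w 2 + (w 2 - z 2 + 1/2))"
    using Zs_bilinear[OF p x1 x2 x12(2)] unfolding m reflect z12 .
  show "z' 1 * z 1 - z' 2 * (z 1 + z 1) - z 2 * z' 1 = - (w' 1 + w' 2)"
    using dZs_bilinear[OF p x1 x1 x12(1)] unfolding m z12 .
  show "z' 1 * z 2 - z' 2 * (z 1 + z 2) - (1 - z 2) * z' 1 = - (w' 1 + (z' 2 - w' 2))"
    using dZs_bilinear[OF p x1 x2 x12(2)] unfolding m reflect z12 .
  show "(z 1)\<^sup>2 = z' 1 + 2 * w 1 + (1/12 - 2 * LS 0 2 5 q)"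
    using Zs_square[OF p x1 k] unfolding z12 .
  show "(z 2)\<^sup>2 = z' 2 + 2 * w 2 + (1/12 - 2 * LS 0 2 5 q)"
    using Zs_square[OF p x2 k] unfolding z12 .
qed

definition zeta1 :: "real \<Rightarrow> real" where "zeta1 q = 1/2 + LS 0 1 1 q - LS 0 1 4 q"
definition zeta2 :: "real \<Rightarrow> real" where "zeta2 q = 1/2 + LS 0 1 2 q - LS 0 1 3 q"

text \<open>Linear combinations of the values of the zeta function at the 5-torsion points \<open>q\<close> and \<open>q\<^sup>2\<close>
  that turn out to be products: \<open>3 \<zeta>(u) - \<zeta>(3u)\<close> and \<open>3 \<zeta>(2u) - \<zeta>(6u)\<close>.\<close>

definition eis1 :: "real \<Rightarrow> real" where "eis1 q = 3 * zeta1 q + zeta2 q - 1"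
definition eis2 :: "real \<Rightarrow> real" where "eis2 q = 3 * zeta2 q - zeta1 q - 1"

text \<open>In logarithms, identities between monomials in q, A, B, C become linear identities
  between exponents.\<close>

definition lnA :: "real \<Rightarrow> real" where "lnA q = ln (qpoch_inf q 5 1) + ln (qpoch_inf q 5 4)"
definition lnB :: "real \<Rightarrow> real" where "lnB q = ln (qpoch_inf q 5 2) + ln (qpoch_inf q 5 3)"
definition lnC :: "real \<Rightarrow> real" where "lnC q = ln (qpoch_inf q 5 5)"

text \<open>The six bilateral relations express w1, w2, dz1, dz2, dw1, dw2 through z1, z2 and e. All
  derivatives are then polynomials in these three quantities divided by q, and the claims reduce to
  polynomial identities.\<close>

lemma derivative_system:
  assumes q: "0 < q" "q < 1"
  obtains a b c where
    "(lnA has_real_derivative a / q) (at q)" "(lnB has_real_derivative b / q) (at q)" "(lnC has_real_derivative c / q) (at q)"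
    "(eis1 has_real_derivative eis1 q * (2 * b + 2 * c - 3 * a) / q) (at q)"
    "(eis2 has_real_derivative eis2 q * (1 + 2 * a + 2 * c - 3 * b) / q) (at q)"
    "1 + 5 * (a - b) = (eis1 q)\<^sup>2 + 11 * eis1 q * eis2 q - (eis2 q)\<^sup>2"
    "-1 + 6 * (a + b) = - ((eis1 q)\<^sup>2 + (eis2 q)\<^sup>2)"
proof -
  define z1 z2 where "z1 = zeta1 q" and "z2 = zeta2 q"
  define w1 where "w1 = 1/12 - LS 0 2 6 q - LS 0 2 4 q"
  define w2 where "w2 = 1/12 - LS 0 2 7 q - LS 0 2 3 q"
  define dz1 where "dz1 = LS 1 1 1 q + LS 1 1 4 q"
  define dz2 where "dz2 = LS 1 1 2 q + LS 1 1 3 q"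
  define dw1 where "dw1 = LS 1 2 4 q - LS 1 2 6 q"
  define dw2 where "dw2 = LS 1 2 3 q - LS 1 2 7 q"
  define e where "e = LS 0 2 5 q"
  note defs = z1_def z2_def zeta1_def zeta2_def w1_def w2_def dz1_def dz2_def dw1_def dw2_def e_def
  have rel: "z1 * z1 - z2 * (z1 + z1) = - (w1 + w1 + w2)"
    "z1 * z2 - (1 - z2) * (z1 + z2) = - (w1 + w2 + (w2 - z2 + 1/2))"
    "dz1 * z1 - dz2 * (z1 + z1) - z2 * dz1 = - (dw1 + dw2)"
    "dz1 * z2 - dz2 * (z1 + z2) - (1 - z2) * dz1 = - (dw1 + (dz2 - dw2))"
    "z1\<^sup>2 = dz1 + 2 * w1 + (1/12 - 2 * e)" "z2\<^sup>2 = dz2 + 2 * w2 + (1/12 - 2 * e)"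
    using bilateral_relations[OF q] unfolding defs by simp_all
  \<comment> \<open>The first two relations form the linear system 2 w1 + w2 = 2 z1 z2 - z1^2 and w1
    + 2 w2 = z1 + 2 z2 - 2 z1 z2 - z2^2 - 1/2.\<close>
  have w1: "w1 = (2 * (2 * z1 * z2 - z1\<^sup>2) - (z1 + 2 * z2 - 2 * z1 * z2 - z2\<^sup>2 - 1/2)) / 3"
    and w2: "w2 = (2 * (z1 + 2 * z2 - 2 * z1 * z2 - z2\<^sup>2 - 1/2) - (2 * z1 * z2 - z1\<^sup>2)) / 3"
    using rel(1,2) by (simp_all add: power2_eq_square algebra_simps)
  have dz: "dz1 = z1\<^sup>2 - 2 * w1 - (1/12 - 2 * e)" "dz2 = z2\<^sup>2 - 2 * w2 - (1/12 - 2 * e)" using rel(5,6) by simp_all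
  define r3 where "r3 = dz1 * z1 - dz2 * (z1 + z1) - z2 * dz1"
  define r4 where "r4 = dz1 * z2 - dz2 * (z1 + z2) - (1 - z2) * dz1 + dz2"
  have dw: "dw1 = - (r3 + r4) / 2" "dw2 = (r4 - r3) / 2"
    using rel(3,4) by (simp_all add: r3_def r4_def)
  \<comment> \<open>The derivation q d/dq applied to log theta(q^a; q^5), with exponent 1 here and 2
    for \<open>b\<close>. The shifts by 1/12 and 1/2 undo the constants in \<open>Ws\<close> and
    \<open>Zs\<close>.\<close>
  define a where "a = 5 * (w1 - 1/12) - z1 + 1/2"
  define b where "b = 5 * (w2 - 1/12) - 2 * z2 + 1"
  have dA: "(lnA has_real_derivative a / q) (at q)"
  proof -
    have e: "a = - (real 1 * LS 0 1 1 q + 5 * LS 0 2 (1 + 5) q) - (real 4 * LS 0 1 4 q + 5 * LS 0 2 (4 + 5) q)"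
      using LS_1_eq[OF q, of 4 0] by (simp add: a_def defs)
    show ?thesis
      unfolding e lnA_def[abs_def] by (rule DERIV_cong[OF DERIV_add[OF DERIV_ln_qpoch_inf[OF q, of 1] DERIV_ln_qpoch_inf[OF q, of 4]]]) (use q in \<open>simp_all add: field_simps\<close>)
  qed
  have dB: "(lnB has_real_derivative b / q) (at q)"
  proof -
    have e: "b = - (real 2 * LS 0 1 2 q + 5 * LS 0 2 (2 + 5) q) - (real 3 * LS 0 1 3 q + 5 * LS 0 2 (3 + 5) q)"
      using LS_1_eq[OF q, of 3 0] by (simp add: b_def defs)
    show ?thesis
      unfolding e lnB_def[abs_def] by (rule DERIV_cong[OF DERIV_add[OF DERIV_ln_qpoch_inf[OF q, of 2] DERIV_ln_qpoch_inf[OF q, of 3]]]) (use q in \<open>simp_all add: field_simps\<close>)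
  qed
  have dC: "(lnC has_real_derivative (- 5 * e) / q) (at q)"
    unfolding lnC_def[abs_def] using LS_1_eq[OF q, of 5 0]
    by (intro DERIV_cong[OF DERIV_ln_qpoch_inf[OF q, of 5]]) (use q in \<open>simp_all add: defs field_simps\<close>)
  \<comment> \<open>The same chain rule on \<open>Zs\<close>; the minus sign arises because p d/dp
    sends \<open>Zs\<close> to minus \<open>dWs\<close>.\<close>
  have d1: "(zeta1 has_real_derivative (dz1 - 5 * dw1) / q) (at q)"
  proof -
    have e: "dz1 - 5 * dw1 = (real 1 * LS 1 1 1 q + 5 * LS 1 2 (1 + 5) q) - (real 4 * LS 1 1 4 q + 5 * LS 1 2 (4 + 5) q)"
      using LS_1_eq[OF q, of 4 1] by (simp add: defs)
    show ?thesis
      unfolding e zeta1_def[abs_def] by (rule DERIV_cong[OF DERIV_diff[OF DERIV_add[OF DERIV_const[of "1/2"] DERIV_LS[OF q, of 1]] DERIV_LS[OF q, of 4]]]) (use q in \<open>simp_all add: field_simps\<close>)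
  qed
  have d2: "(zeta2 has_real_derivative (2 * dz2 - 5 * dw2) / q) (at q)"
  proof -
    have e: "2 * dz2 - 5 * dw2 = (real 2 * LS 1 1 2 q + 5 * LS 1 2 (2 + 5) q) - (real 3 * LS 1 1 3 q + 5 * LS 1 2 (3 + 5) q)"
      using LS_1_eq[OF q, of 3 1] by (simp add: defs)
    show ?thesis
      unfolding e zeta2_def[abs_def] by (rule DERIV_cong[OF DERIV_diff[OF DERIV_add[OF DERIV_const[of "1/2"] DERIV_LS[OF q, of 2]] DERIV_LS[OF q, of 3]]]) (use q in \<open>simp_all add: field_simps\<close>)
  qed
  have s: "eis1 q = 3 * z1 + z2 - 1" "eis2 q = 3 * z2 - z1 - 1" by (simp_all add: eis1_def eis2_def z1_def z2_def)
  have poly1: "3 * (dz1 - 5 * dw1) + (2 * dz2 - 5 * dw2) = eis1 q * (2 * b + 2 * (- 5 * e) - 3 * a)"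
    unfolding s a_def b_def dw r3_def r4_def dz w1 w2 by (simp add: field_simps power2_eq_square)
  have poly2: "3 * (2 * dz2 - 5 * dw2) - (dz1 - 5 * dw1) = eis2 q * (1 + 2 * a + 2 * (- 5 * e) - 3 * b)"
    unfolding s a_def b_def dw r3_def r4_def dz w1 w2 by (simp add: field_simps power2_eq_square)
  have "(eis1 has_real_derivative (3 * ((dz1 - 5 * dw1) / q) + (2 * dz2 - 5 * dw2) / q)) (at q)"
    unfolding eis1_def[abs_def] by (auto intro!: derivative_eq_intros d1 d2)
  also have "3 * ((dz1 - 5 * dw1) / q) + (2 * dz2 - 5 * dw2) / q = eis1 q * (2 * b + 2 * (- 5 * e) - 3 * a) / q"
    unfolding poly1[symmetric] by (simp add: add_divide_distrib)
  finally have ds1: "(eis1 has_real_derivative eis1 q * (2 * b + 2 * (- 5 * e) - 3 * a) / q) (at q)" .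
  have "(eis2 has_real_derivative (3 * ((2 * dz2 - 5 * dw2) / q) - (dz1 - 5 * dw1) / q)) (at q)"
    unfolding eis2_def[abs_def] by (auto intro!: derivative_eq_intros d1 d2)
  also have "3 * ((2 * dz2 - 5 * dw2) / q) - (dz1 - 5 * dw1) / q = eis2 q * (1 + 2 * a + 2 * (- 5 * e) - 3 * b) / q"
    unfolding poly2[symmetric] by (simp add: diff_divide_distrib)
  finally have ds2: "(eis2 has_real_derivative eis2 q * (1 + 2 * a + 2 * (- 5 * e) - 3 * b) / q) (at q)" .
  have X: "1 + 5 * (a - b) = (eis1 q)\<^sup>2 + 11 * eis1 q * eis2 q - (eis2 q)\<^sup>2"
    unfolding s a_def b_def w1 w2 by (simp add: field_simps power2_eq_square)
  have h: "-1 + 6 * (a + b) = - ((eis1 q)\<^sup>2 + (eis2 q)\<^sup>2)"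
    unfolding s a_def b_def w1 w2 by (simp add: field_simps power2_eq_square)
  show ?thesis by (rule that[OF dA dB dC ds1 ds2 X h])
qed

section \<open>Product formulas from constancy and a limit at 0\<close>

lemma eventually_at_right_unit: "\<forall>\<^sub>F q in at_right (0::real). 0 < q \<and> q < 1"
  using eventually_at_right_real[of 0 "1::real"] by simp

lemma zero_derivative_limit:
  fixes f :: "real \<Rightarrow> real"
  assumes deriv: "\<And>x. 0 < x \<Longrightarrow> x < 1 \<Longrightarrow> (f has_real_derivative 0) (at x)"
    and lim: "(f \<longlongrightarrow> L) (at_right 0)" and q: "0 < q" "q < 1"
  shows "f q = L"
proof -
  have "\<forall>\<^sub>F x in at_right 0. f q = f x"
    using eventually_at_right_unit
  proof eventually_elim
    case (elim x)
    show ?case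
      by (rule DERIV_isconst3[of 0 1]) (use elim q deriv in auto)
  qed
  from tendsto_cong[OF this] have "(f \<longlongrightarrow> f q) (at_right 0)"
    by (metis (no_types) tendsto_const)
  then show ?thesis using lim tendsto_unique[of "at_right (0::real)"] by simp
qed

lemma LS_bounds:
  assumes q: "0 < q" "q < 1" and b: "0 < b"
  shows "q ^ b \<le> LS 0 1 b q" "LS 0 1 b q \<le> q ^ b / (1 - q)\<^sup>2"
proof -
  note s = LS_sums[OF q b zero_le_one, of 1]
  have "q ^ b * 1 \<le> q ^ b * (1 / (1 - q ^ 5))"
    using q power_less_one_iff[of q 5] by (intro mult_left_mono) (auto simp: field_simps)
  also have "\<dots> = (\<Sum>n\<in>{0}. real (Suc n) ^ 0 * (q ^ Suc n) ^ b / (1 - (q ^ Suc n) ^ 5) ^ 1)" by simp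
  also have "\<dots> \<le> (\<Sum>n. real (Suc n) ^ 0 * (q ^ Suc n) ^ b / (1 - (q ^ Suc n) ^ 5) ^ 1)"
    by (rule sum_le_suminf[OF sums_summable[OF s]]) (use LS_term_nonneg[OF q, of _ 0 b 1] in auto)
  also have "\<dots> = LS 0 1 b q" using s by (simp add: sums_iff)
  finally show "q ^ b \<le> LS 0 1 b q" by simp
  have "(\<lambda>n. q ^ b / (1 - q) * q ^ n) sums (q ^ b / (1 - q) * (1 / (1 - q)))"
    by (intro sums_mult geometric_sums) (use q in auto)
  then have g: "(\<lambda>n. q ^ b / (1 - q) * q ^ n) sums (q ^ b / (1 - q)\<^sup>2)"
    by (simp add: power2_eq_square)
  have "real (Suc n) ^ 0 * (q ^ Suc n) ^ b / (1 - (q ^ Suc n) ^ 5) ^ 1 \<le> q ^ b / (1 - q) * q ^ n" for n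
  proof -
    have "(q ^ Suc n) ^ b = q ^ b * (q ^ n) ^ b" by (simp add: power_mult_distrib)
    moreover have "(q ^ n) ^ b \<le> (q ^ n) ^ 1"
      by (rule power_decreasing) (use b q in \<open>auto simp: power_le_one\<close>)
    ultimately have "(q ^ Suc n) ^ b \<le> q ^ b * q ^ n" using q by (simp add: mult_left_mono)
    then have "(q ^ Suc n) ^ b / (1 - (q ^ Suc n) ^ 5) \<le> q ^ b * q ^ n / (1 - q)"
      using power5_gap[OF q, of n] q by (intro frac_le) auto
    then show ?thesis by simp
  qed
  then show "LS 0 1 b q \<le> q ^ b / (1 - q)\<^sup>2" by (rule sums_le[OF _ s g])
qed

lemma LS_quotient_tendsto:
  assumes b: "0 < b"
  shows "((\<lambda>q. LS 0 1 b q / q ^ b) \<longlongrightarrow> 1) (at_right 0)"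
proof (rule tendsto_sandwich)
  show "((\<lambda>q::real. 1) \<longlongrightarrow> 1) (at_right 0)" by simp
  have "((\<lambda>q::real. 1 / (1 - q)\<^sup>2) \<longlongrightarrow> 1 / (1 - 0)\<^sup>2) (at_right 0)"
    by (intro tendsto_intros) auto
  then show "((\<lambda>q::real. 1 / (1 - q)\<^sup>2) \<longlongrightarrow> 1) (at_right 0)" by simp
  show "\<forall>\<^sub>F q in at_right 0. 1 \<le> LS 0 1 b q / q ^ b"
    using eventually_at_right_unit by eventually_elim (use LS_bounds(1)[OF _ _ b] in simp)
  show "\<forall>\<^sub>F q in at_right 0. LS 0 1 b q / q ^ b \<le> 1 / (1 - q)\<^sup>2"
    using eventually_at_right_unit
  proof eventually_elim
    case (elim q)
    then have "LS 0 1 b q / q ^ b \<le> (q ^ b / (1 - q)\<^sup>2) / q ^ b"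
      using LS_bounds(2)[OF _ _ b] by (intro divide_right_mono) auto
    then show ?case using elim by simp
  qed
qed

lemma LS_tendsto:
  assumes b: "0 < b"
  shows "((\<lambda>q. LS 0 1 b q) \<longlongrightarrow> 0) (at_right 0)"
    and "((\<lambda>q. LS 0 1 b q / q) \<longlongrightarrow> (if b = 1 then 1 else 0)) (at_right 0)"
proof -
  have pw: "((\<lambda>q::real. q ^ n) \<longlongrightarrow> (if n = 0 then 1 else 0)) (at_right 0)" for n
    by (cases n) (auto intro!: tendsto_eq_intros)
  have "((\<lambda>q. LS 0 1 b q / q ^ b * q ^ b) \<longlongrightarrow> 1 * 0) (at_right 0)"
    using tendsto_mult[OF LS_quotient_tendsto[OF b] pw[of b]] b by simp
  moreover have "\<forall>\<^sub>F q in at_right 0. LS 0 1 b q / q ^ b * q ^ b = LS 0 1 b q"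
    using eventually_at_right_unit by eventually_elim simp
  ultimately have "((\<lambda>q. LS 0 1 b q) \<longlongrightarrow> 1 * 0) (at_right 0)"
    by (rule Lim_transform_eventually)
  then show "((\<lambda>q. LS 0 1 b q) \<longlongrightarrow> 0) (at_right 0)" by simp
  have "((\<lambda>q. LS 0 1 b q / q ^ b * q ^ (b - 1)) \<longlongrightarrow> 1 * (if b - 1 = 0 then 1 else 0)) (at_right 0)"
    by (rule tendsto_mult[OF LS_quotient_tendsto[OF b] pw])
  moreover have "\<forall>\<^sub>F q in at_right 0. LS 0 1 b q / q ^ b * q ^ (b - 1) = LS 0 1 b q / q"
    using eventually_at_right_unit
  proof eventually_elim
    case (elim q)
    obtain c where "b = Suc c" using b gr0_implies_Suc by blast
    then show ?case using elim by simp
  qed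
  ultimately have "((\<lambda>q. LS 0 1 b q / q) \<longlongrightarrow> 1 * (if b - 1 = 0 then 1 else 0)) (at_right 0)"
    by (rule Lim_transform_eventually)
  then show "((\<lambda>q. LS 0 1 b q / q) \<longlongrightarrow> (if b = 1 then 1 else 0)) (at_right 0)"
    using b by (cases "b = 1") simp_all
qed

lemma ln_qpoch_inf_tendsto:
  assumes b: "0 < b"
  shows "((\<lambda>q. ln (qpoch_inf q 5 b)) \<longlongrightarrow> 0) (at_right 0)"
proof (rule Lim_null_comparison[OF _ LS_tendsto(1)[OF b]])
  show "\<forall>\<^sub>F q in at_right 0. norm (ln (qpoch_inf q 5 b)) \<le> LS 0 1 b q"
    using eventually_at_right_unit
  proof eventually_elim
    case (elim q)
    then have q: "0 < q" "q < 1" by auto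
    define g where "g n = (q ^ Suc n) ^ b / (1 - (q ^ Suc n) ^ 5)" for n
    have g: "0 \<le> g n" for n using LS_term_nonneg[OF q, of n 0 b 1] by (simp add: g_def)
    have s: "g sums LS 0 1 b q" using LS_sums[OF q b, of 0 1] by (simp add: g_def[abs_def])
    have le: "norm (1 / real (Suc n) * g n) \<le> g n" for n
      using g[of n] mult_right_mono[of "1 / real (Suc n)" 1 "g n"] by (simp add: abs_mult)
    have "norm (\<Sum>n. 1 / real (Suc n) * g n) \<le> suminf g"
      by (rule norm_suminf_le[OF le sums_summable[OF s]])
    then show ?case
      unfolding ln_qpoch_inf[OF q b] using s by (simp add: sums_iff g_def[abs_def])
  qed
qed

lemma lnABC_tendsto:
  "(lnA \<longlongrightarrow> 0) (at_right 0)" "(lnB \<longlongrightarrow> 0) (at_right 0)" "(lnC \<longlongrightarrow> 0) (at_right 0)"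
  unfolding lnA_def[abs_def] lnB_def[abs_def] lnC_def[abs_def]
  using tendsto_add[OF ln_qpoch_inf_tendsto[of 1] ln_qpoch_inf_tendsto[of 4]]
    tendsto_add[OF ln_qpoch_inf_tendsto[of 2] ln_qpoch_inf_tendsto[of 3]] ln_qpoch_inf_tendsto[of 5]
  by simp_all

text \<open>In \<open>eis1\<close> the constants add up to 3/2 + 1/2 - 1 = 1. In \<open>eis2\<close>
  they cancel, and the leading term is -q, from the Lambert series with b = 1.\<close>

lemma eis_tendsto:
  "(eis1 \<longlongrightarrow> 1) (at_right 0)" "((\<lambda>q. eis2 q / q) \<longlongrightarrow> -1) (at_right 0)"
proof -
  show "(eis1 \<longlongrightarrow> 1) (at_right 0)"
    unfolding eis1_def[abs_def] zeta1_def zeta2_def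
    by (auto intro!: tendsto_eq_intros LS_tendsto(1)[unfolded One_nat_def])
  have "((\<lambda>q. 3 * (LS 0 1 2 q / q - LS 0 1 3 q / q) - (LS 0 1 1 q / q - LS 0 1 4 q / q)) \<longlongrightarrow>
      3 * ((if (2::nat) = 1 then 1 else 0) - (if (3::nat) = 1 then 1 else 0)) - ((if (1::nat) = 1 then 1 else 0) - (if (4::nat) = 1 then 1 else 0))) (at_right 0)"
    by (intro tendsto_diff tendsto_mult tendsto_const LS_tendsto(2)) auto
  then have "((\<lambda>q. 3 * (LS 0 1 2 q / q - LS 0 1 3 q / q) - (LS 0 1 1 q / q - LS 0 1 4 q / q)) \<longlongrightarrow> -1) (at_right 0)"
    by simp
  then show "((\<lambda>q. eis2 q / q) \<longlongrightarrow> -1) (at_right 0)"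
    by (rule Lim_transform_eventually)
      (use eventually_at_right_unit in \<open>auto elim!: eventually_mono simp: eis2_def zeta1_def zeta2_def field_simps\<close>)
qed

text \<open>The product with the inverse exponential is differentiated, not the logarithm of
  \<open>eis1\<close>, because nothing is known beforehand about zeros or the sign of
  \<open>eis1\<close>.\<close>

lemma eis1_eq:
  assumes q: "0 < q" "q < 1"
  shows "eis1 q = exp (2 * lnB q + 2 * lnC q - 3 * lnA q)"
proof -
  have "eis1 q * exp (3 * lnA q - 2 * lnB q - 2 * lnC q) = 1"
  proof (rule zero_derivative_limit[OF _ _ q])
    fix x :: real assume x: "0 < x" "x < 1"
    from derivative_system[OF x] obtain a b c where d:
      "(lnA has_real_derivative a / x) (at x)" "(lnB has_real_derivative b / x) (at x)" "(lnC has_real_derivative c / x) (at x)"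
      "(eis1 has_real_derivative eis1 x * (2 * b + 2 * c - 3 * a) / x) (at x)" by metis
    show "((\<lambda>q. eis1 q * exp (3 * lnA q - 2 * lnB q - 2 * lnC q)) has_real_derivative 0) (at x)"
      using x by (auto intro!: derivative_eq_intros d simp: field_simps)
  next
    show "((\<lambda>q. eis1 q * exp (3 * lnA q - 2 * lnB q - 2 * lnC q)) \<longlongrightarrow> 1) (at_right 0)"
      by (auto intro!: tendsto_eq_intros eis_tendsto lnABC_tendsto)
  qed
  then have "eis1 q = 1 / exp (3 * lnA q - 2 * lnB q - 2 * lnC q)" by (simp add: field_simps)
  also have "\<dots> = exp (2 * lnB q + 2 * lnC q - 3 * lnA q)" by (simp add: exp_diff exp_add)
  finally show ?thesis .
qed

text \<open>Division by q compensates the summand 1 in the logarithmic derivative and produces the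
  limit -1.\<close>

lemma eis2_eq:
  assumes q: "0 < q" "q < 1"
  shows "eis2 q = - q * exp (2 * lnA q + 2 * lnC q - 3 * lnB q)"
proof -
  have "eis2 q / q * exp (3 * lnB q - 2 * lnA q - 2 * lnC q) = -1"
  proof (rule zero_derivative_limit[OF _ _ q])
    fix x :: real assume x: "0 < x" "x < 1"
    from derivative_system[OF x] obtain a b c where d:
      "(lnA has_real_derivative a / x) (at x)" "(lnB has_real_derivative b / x) (at x)" "(lnC has_real_derivative c / x) (at x)"
      "(eis2 has_real_derivative eis2 x * (1 + 2 * a + 2 * c - 3 * b) / x) (at x)" by metis
    show "((\<lambda>q. eis2 q / q * exp (3 * lnB q - 2 * lnA q - 2 * lnC q)) has_real_derivative 0) (at x)"
      using x by (auto intro!: derivative_eq_intros d simp: field_simps)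
  next
    have "((\<lambda>q. exp (3 * lnB q - 2 * lnA q - 2 * lnC q)) \<longlongrightarrow> 1) (at_right 0)"
      by (auto intro!: tendsto_eq_intros lnABC_tendsto)
    from tendsto_mult[OF eis_tendsto(2) this]
    show "((\<lambda>q. eis2 q / q * exp (3 * lnB q - 2 * lnA q - 2 * lnC q)) \<longlongrightarrow> -1) (at_right 0)" by simp
  qed
  then have "eis2 q = - q * (1 / exp (3 * lnB q - 2 * lnA q - 2 * lnC q))" using q by (simp add: field_simps)
  also have "1 / exp (3 * lnB q - 2 * lnA q - 2 * lnC q) = exp (2 * lnA q + 2 * lnC q - 3 * lnB q)"
    by (simp add: exp_diff exp_add)
  finally show ?thesis .
qed

definition lnX :: "real \<Rightarrow> real" where "lnX q = ln q + 5 * (lnA q - lnB q)"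
definition lnh :: "real \<Rightarrow> real" where "lnh q = 6 * (lnA q + lnB q) - ln q"

lemma DERIV_lnX_lnh:
  assumes q: "0 < q" "q < 1"
  defines "S \<equiv> exp (ln q + 4 * lnC q - lnA q - lnB q)"
  shows "(lnX has_real_derivative S * (exp (- lnX q) - 11 - exp (lnX q)) / q) (at q)"
    and "(lnh has_real_derivative - (S * (exp (- lnX q) + exp (lnX q))) / q) (at q)"
proof -
  from derivative_system[OF q] obtain a b where d:
    "(lnA has_real_derivative a / q) (at q)" "(lnB has_real_derivative b / q) (at q)"
    "1 + 5 * (a - b) = (eis1 q)\<^sup>2 + 11 * eis1 q * eis2 q - (eis2 q)\<^sup>2"
    "-1 + 6 * (a + b) = - ((eis1 q)\<^sup>2 + (eis2 q)\<^sup>2)" by metis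
  have e2: "eis2 q = - exp (ln q + 2 * lnA q + 2 * lnC q - 3 * lnB q)"
    unfolding eis2_eq[OF q] using q by (simp add: exp_add exp_diff)
  have s1: "(eis1 q)\<^sup>2 = S * exp (- lnX q)"
    unfolding eis1_eq[OF q] S_def lnX_def by (simp add: exp_double[symmetric] mult_exp_exp)
  have s2: "(eis2 q)\<^sup>2 = S * exp (lnX q)"
    unfolding e2 S_def lnX_def by (simp add: exp_double[symmetric] mult_exp_exp)
  have s12: "eis1 q * eis2 q = - S"
    unfolding e2 eis1_eq[OF q] S_def by (simp add: mult_exp_exp)
  have "(lnX has_real_derivative (1 + 5 * (a - b)) / q) (at q)"
    unfolding lnX_def[abs_def] using q by (auto intro!: derivative_eq_intros d(1,2) simp: field_simps)
  then show "(lnX has_real_derivative S * (exp (- lnX q) - 11 - exp (lnX q)) / q) (at q)"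
    unfolding d(3) mult.assoc s12 s1 s2 by (simp add: algebra_simps)
  have "(lnh has_real_derivative (-1 + 6 * (a + b)) / q) (at q)"
    unfolding lnh_def[abs_def] using q by (auto intro!: derivative_eq_intros d(1,2) simp: field_simps)
  then show "(lnh has_real_derivative - (S * (exp (- lnX q) + exp (lnX q))) / q) (at q)"
    unfolding d(4) s1 s2 by (simp add: algebra_simps)
qed

text \<open>Put Y = 1/X - 11 - X. Then q Y' = -(1/X + X) q (ln X)' = -(1/X + X) S Y, and -(1/X + X)
  S is also the value of q (ln h)'. So Y / h has derivative 0.\<close>

theorem inverse_X_identity:
  assumes q: "0 < q" "q < 1"
  shows "exp (- lnX q) - 11 - exp (lnX q) = exp (lnh q)"
proof -
  have "(exp (- lnX q) - 11 - exp (lnX q)) * exp (- lnh q) = 1"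
  proof (rule zero_derivative_limit[OF _ _ q])
    fix x :: real assume x: "0 < x" "x < 1"
    show "((\<lambda>q. (exp (- lnX q) - 11 - exp (lnX q)) * exp (- lnh q)) has_real_derivative 0) (at x)"
      using x by (auto intro!: derivative_eq_intros DERIV_lnX_lnh simp: field_simps)
  next
    \<comment> \<open>Multiplied out, ln q cancels from 1 / (X h), while 11 / h and X / h acquire
      factors q and q^2. The limit is then visible although 1 / X and h blow up at 0.\<close>
    have "((\<lambda>q. exp (-11 * lnA q - lnB q) - (11 * q * exp (- (6 * (lnA q + lnB q))) + q * q * exp (5 * (lnA q - lnB q) - 6 * (lnA q + lnB q))))
        \<longlongrightarrow> 1) (at_right 0)"
      by (auto intro!: tendsto_eq_intros lnABC_tendsto)
    then show "((\<lambda>q. (exp (- lnX q) - 11 - exp (lnX q)) * exp (- lnh q)) \<longlongrightarrow> 1) (at_right 0)"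
    proof (rule Lim_transform_eventually)
      show "\<forall>\<^sub>F q in at_right 0. exp (-11 * lnA q - lnB q) - (11 * q * exp (- (6 * (lnA q + lnB q))) + q * q * exp (5 * (lnA q - lnB q) - 6 * (lnA q + lnB q)))
          = (exp (- lnX q) - 11 - exp (lnX q)) * exp (- lnh q)"
        using eventually_at_right_unit
      proof eventually_elim
        case (elim q)
        have "exp (- lnX q) * exp (- lnh q) = exp (-11 * lnA q - lnB q)"
          unfolding mult_exp_exp by (simp add: lnX_def lnh_def)
        moreover have "exp (- lnh q) = exp (ln q) * exp (- (6 * (lnA q + lnB q)))"
          unfolding mult_exp_exp by (simp add: lnh_def)
        then have "exp (- lnh q) = q * exp (- (6 * (lnA q + lnB q)))"
          using elim by simp
        moreover have "exp (lnX q) = q * exp (5 * (lnA q - lnB q))"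
          using elim by (simp add: lnX_def exp_add)
        moreover have "exp (5 * (lnA q - lnB q)) * exp (- (6 * (lnA q + lnB q))) = exp (5 * (lnA q - lnB q) - 6 * (lnA q + lnB q))"
          unfolding mult_exp_exp by simp
        ultimately show ?case by (simp add: algebra_simps)
      qed
    qed
  qed
  then show ?thesis by (simp add: exp_minus field_simps)
qed

subsection \<open>The continued fraction as a function of the nome\<close>

lemma exp_lnABC:
  assumes q: "0 < q" "q < 1"
  shows "exp (lnA q) = qpoch_inf q 5 1 * qpoch_inf q 5 4"
    and "exp (lnB q) = qpoch_inf q 5 2 * qpoch_inf q 5 3"
    and "exp (lnC q) = qpoch_inf q 5 5"
  using qpoch_inf_pos[OF q, of 5] by (simp_all add: lnA_def lnB_def lnC_def exp_add)

lemma RR_eq_exp: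
  assumes q: "0 < q" "q < 1"
  shows "RR q = exp (lnX q / 5)"
proof -
  have "lnX q / 5 = ln q / 5 + (lnA q - lnB q)" by (simp add: lnX_def)
  then have "exp (lnX q / 5) = exp (ln q / 5) * (exp (lnA q) / exp (lnB q))"
    by (simp only: exp_add exp_diff)
  also have "exp (ln q / 5) = q powr (1/5)" using q by (simp add: powr_def)
  finally show ?thesis unfolding RR_eq_product[OF q] exp_lnABC[OF q] by simp
qed

lemma RR_power5: "0 < q \<Longrightarrow> q < 1 \<Longrightarrow> RR q ^ 5 = exp (lnX q)"
  by (simp add: RR_eq_exp flip: exp_of_nat_mult)

lemma RR_pos: "0 < q \<Longrightarrow> q < 1 \<Longrightarrow> 0 < RR q"
  by (simp add: RR_eq_exp)

lemma RR_identity: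
  assumes q: "0 < q" "q < 1"
  shows "1 / RR q ^ 5 - 11 - RR q ^ 5 = exp (lnh q)"
  unfolding RR_power5[OF q] inverse_X_identity[OF q, symmetric] by (simp add: exp_minus divide_inverse)

text \<open>Here \<open>exp (ln q / 6 + 4 * (lnA q + lnB q + lnC q))\<close> is the fourth power of the eta function.\<close>

lemma DERIV_RR:
  assumes q: "0 < q" "q < 1"
  shows "(RR has_real_derivative
    RR q / 5 * (exp (ln q / 6 + 4 * (lnA q + lnB q + lnC q)) * exp (lnh q / 6)) / q) (at q)"
proof -
  define S where "S = exp (ln q + 4 * lnC q - lnA q - lnB q)"
  have "(lnX has_real_derivative S * exp (lnh q) / q) (at q)"
    using DERIV_lnX_lnh(1)[OF q] unfolding inverse_X_identity[OF q] S_def .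
  \<comment> \<open>Equivalently S h^(5/6) = q^(1/6) (A B C)^4; the sixth root in the theorem
    originates here.\<close>
  moreover have "S * exp (lnh q) = exp (ln q / 6 + 4 * (lnA q + lnB q + lnC q)) * exp (lnh q / 6)"
    unfolding S_def mult_exp_exp by (simp add: lnh_def field_simps)
  ultimately have d: "(lnX has_real_derivative
      (exp (ln q / 6 + 4 * (lnA q + lnB q + lnC q)) * exp (lnh q / 6)) / q) (at q)" by simp
  have "((\<lambda>q. exp (lnX q / 5)) has_real_derivative
    RR q / 5 * (exp (ln q / 6 + 4 * (lnA q + lnB q + lnC q)) * exp (lnh q / 6)) / q) (at q)"
    unfolding RR_eq_exp[OF q] by (rule derivative_eq_intros d refl | simp)+
  moreover have "\<forall>\<^sub>F x in nhds q. exp (lnX x / 5) = RR x"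
    using eventually_nhds_in_open[of "{0<..<1}" q] q
    by (auto elim!: eventually_mono simp: RR_eq_exp)
  ultimately show ?thesis
    by (subst DERIV_cong_ev[OF refl _ refl, symmetric]) auto
qed

lemma RR_tendsto_0: "(RR \<longlongrightarrow> 0) (at_right 0)"
proof (rule Lim_transform_eventually)
  have "((\<lambda>q::real. q powr (1/5) * exp (lnA q - lnB q)) \<longlongrightarrow> 0 powr (1/5) * exp (0 - 0)) (at_right 0)"
    by (intro tendsto_intros lnABC_tendsto tendsto_powr')
      (auto simp: eventually_at_right_less less_imp_le eventually_mono[OF eventually_at_right_unit])
  then show "((\<lambda>q::real. q powr (1/5) * exp (lnA q - lnB q)) \<longlongrightarrow> 0) (at_right 0)" by simp
  show "\<forall>\<^sub>F q in at_right 0. q powr (1/5) * exp (lnA q - lnB q) = RR q"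
    using eventually_at_right_unit
    by eventually_elim (simp add: RR_eq_exp lnX_def powr_def add_divide_distrib exp_add)
qed

text \<open>The first factor of A alone gives A B <= 1 - q, and (A B)^6 <= A B. This crude bound
  sends h to 0 as q tends to 1, where the modular inversion would otherwise be used.\<close>

lemma exp_lnh_le:
  assumes q: "0 < q" "q < 1"
  shows "exp (lnh q) \<le> (1 - q) / q"
proof -
  have le1: "qpoch_inf q 5 b \<le> 1" and le2: "qpoch_inf q 5 b \<le> 1 - q ^ b" if b: "0 < b" for b
  proof -
    have f: "0 \<le> 1 - q ^ (5 * k + b)" "1 - q ^ (5 * k + b) \<le> 1" for k
      using q b by (auto simp: power_le_one)
    show "qpoch_inf q 5 b \<le> 1"
      by (rule LIMSEQ_le_const2[OF qpoch_inf_LIMSEQ[OF q, of 5 b]]) (use b f in \<open>auto intro!: prod_le_1\<close>)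
    have "(\<Prod>k<Suc n. 1 - q ^ (5 * k + b)) \<le> 1 - q ^ b" for n
    proof -
      have "(\<Prod>k<n. 1 - q ^ (5 * Suc k + b)) \<le> 1" using f by (intro prod_le_1) blast
      then have "(1 - q ^ (5 * 0 + b)) * (\<Prod>k<n. 1 - q ^ (5 * Suc k + b)) \<le> (1 - q ^ (5 * 0 + b)) * 1"
        by (rule mult_left_mono[OF _ f(1)])
      then show ?thesis unfolding prod.lessThan_Suc_shift by simp
    qed
    then show "qpoch_inf q 5 b \<le> 1 - q ^ b"
      by (intro LIMSEQ_le_const2[OF LIMSEQ_Suc[OF qpoch_inf_LIMSEQ[OF q]]]) (use b in auto)
  qed
  define x where "x = exp (lnA q + lnB q)"
  have "qpoch_inf q 5 1 * qpoch_inf q 5 4 \<le> (1 - q ^ 1) * 1"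
    by (intro mult_mono le1 le2) (use q qpoch_inf_pos[OF q, of 5] in \<open>auto simp: less_imp_le\<close>)
  moreover have "qpoch_inf q 5 2 * qpoch_inf q 5 3 \<le> 1 * 1"
    by (intro mult_mono le1) (use q qpoch_inf_pos[OF q, of 5] in \<open>auto simp: less_imp_le\<close>)
  ultimately have "exp (lnA q) * exp (lnB q) \<le> (1 - q) * 1"
    unfolding exp_lnABC[OF q] by (intro mult_mono) (use q qpoch_inf_pos[OF q, of 5] in \<open>auto simp: less_imp_le\<close>)
  then have x: "0 < x" "x \<le> 1 - q" by (simp_all add: x_def exp_add)
  have "exp (lnh q) = x ^ 6 / q"
    using q by (simp add: x_def lnh_def exp_diff flip: exp_of_nat_mult)
  also have "\<dots> \<le> (1 - q) / q"
  proof (rule divide_right_mono)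
    have "x ^ 6 \<le> x ^ 1" by (rule power_decreasing) (use x q in auto)
    then show "x ^ 6 \<le> 1 - q" using x by simp
  qed (use q in simp)
  finally show ?thesis .
qed

text \<open>The numerator 1 - 11 x^5 - x^10 is, up to sign, a factor of Klein's vertex form of the
  icosahedron, hence the name.\<close>

lemma icosahedral_antimono:
  fixes x y :: real
  assumes "0 < x" "x \<le> y"
  shows "1 / y ^ 5 - 11 - y ^ 5 \<le> 1 / x ^ 5 - 11 - x ^ 5"
proof -
  have "x ^ 5 \<le> y ^ 5" by (rule power_mono) (use assms in auto)
  moreover from this have "1 / y ^ 5 \<le> 1 / x ^ 5" using assms by (intro frac_le) auto
  ultimately show ?thesis by linarith
qed

lemma x0_properties: "0 < x0" "1 / x0 ^ 5 - 11 - x0 ^ 5 = 0"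
proof -
  define s where "s = sqrt (5::real)"
  define c where "c = (-11 + 5 * s) / 2"
  have s: "s * s = 5" by (simp add: s_def)
  \<comment> \<open>2.2 = 11/5 is exactly the bound that makes \<open>c\<close> positive.\<close>
  have "2.2 < s" unfolding s_def by (rule real_less_rsqrt) (simp add: power2_eq_square)
  then have c: "0 < c" by (simp add: c_def)
  have x0: "x0 = root 5 c" by (simp add: x0_def c_def s_def)
  show "0 < x0" using c by (simp add: x0)
  have x5: "x0 ^ 5 = c" using c by (simp add: x0)
  have "c * c + 11 * c = 1"
    unfolding c_def using s by (simp add: field_simps)
  then show "1 / x0 ^ 5 - 11 - x0 ^ 5 = 0" unfolding x5 using c by (simp add: field_simps)
qed

lemma RR_less_x0:
  assumes q: "0 < q" "q < 1"
  shows "RR q < x0"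
  using icosahedral_antimono[of x0 "RR q"] RR_identity[OF q] x0_properties exp_gt_zero[of "lnh q"] by linarith

lemma icosahedral_pos:
  assumes "0 < y" "y < x0"
  shows "0 < 1 / y ^ 5 - 11 - y ^ 5"
proof -
  have "y ^ 5 < x0 ^ 5" using assms by (intro power_strict_mono) auto
  moreover from this have "1 / x0 ^ 5 < 1 / y ^ 5" using assms by (intro divide_strict_left_mono) auto
  ultimately show ?thesis using x0_properties(2) by linarith
qed

lemma RR_surj:
  assumes y: "0 < y" "y < x0"
  obtains q where "0 < q" "q < 1" "RR q = y"
proof -
  have "\<forall>\<^sub>F q in at_right 0. RR q < y" by (rule order_tendstoD(2)[OF RR_tendsto_0 y(1)])
  from eventually_happens[OF eventually_conj[OF this eventually_at_right_unit]]
  obtain q0 where q0: "0 < q0" "q0 < 1" "RR q0 < y" by (auto simp: trivial_limit_at_right_real)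
  define e where "e = 1 / y ^ 5 - 11 - y ^ 5"
  have e: "0 < e" using icosahedral_pos[OF y] by (simp add: e_def)
  \<comment> \<open>The solution of (1 - q1) / q1 = e / 2. It puts h(q1) below the value e taken at
    y, so \<open>RR q1\<close> exceeds y by monotonicity, and the intermediate value theorem
    applies.\<close>
  define q1 where "q1 = 1 / (1 + e / 2)"
  have "0 < e * e + e * 2" using e by (intro add_pos_pos) auto
  then have q1: "0 < q1" "q1 < 1" "(1 - q1) / q1 < e" using e by (auto simp: q1_def field_simps)
  have "y < RR q1"
    using icosahedral_antimono[of "RR q1" y] RR_pos[OF q1(1,2)] RR_identity[OF q1(1,2)] exp_lnh_le[OF q1(1,2)] q1(3)
    unfolding e_def by linarith
  have "continuous_on {0<..<1} RR"
    by (intro continuous_at_imp_continuous_on ballI DERIV_isCont[OF DERIV_RR]) auto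
  then have "connected (RR ` {0<..<1})" by (rule connected_continuous_image) simp
  then have "{RR q0..RR q1} \<subseteq> RR ` {0<..<1}"
    by (rule connected_contains_Icc) (use q0 q1 in auto)
  moreover have "y \<in> {RR q0..RR q1}" using q0 \<open>y < RR q1\<close> by simp
  ultimately have "y \<in> RR ` {0<..<1}" by blast
  then show ?thesis using that by auto
qed

subsection \<open>The eta function on the imaginary axis\<close>

lemma qpoch_inf_1_1:
  assumes q: "0 < q" "q < 1"
  shows "qpoch_inf q 1 1 = exp (lnA q + lnB q + lnC q)"
proof (rule LIMSEQ_unique)
  define f where "f k = 1 - q ^ Suc k" for k
  have 5: "(\<Prod>k<5 * n. f k) = (\<Prod>k<n. f (5 * k)) * (\<Prod>k<n. f (5 * k + 1)) * (\<Prod>k<n. f (5 * k + 2)) * (\<Prod>k<n. f (5 * k + 3)) * (\<Prod>k<n. f (5 * k + 4))" for n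
    by (induction n) (simp_all add: eval_nat_numeral mult_ac)
  have "(\<lambda>n. \<Prod>k<5 * n. f k) \<longlonglongrightarrow> qpoch_inf q 1 1"
    using qpoch_LIMSEQ[OF q] unfolding qpoch_def[abs_def] f_def
    by (rule filterlim_compose) (auto intro!: filterlim_subseq strict_monoI)
  then show "(\<lambda>n. (\<Prod>k<n. f (5 * k)) * (\<Prod>k<n. f (5 * k + 1)) * (\<Prod>k<n. f (5 * k + 2)) * (\<Prod>k<n. f (5 * k + 3)) * (\<Prod>k<n. f (5 * k + 4))) \<longlonglongrightarrow> qpoch_inf q 1 1"
    unfolding 5 .
  have l: "(\<lambda>n. \<Prod>k<n. f (5 * k + b)) \<longlonglongrightarrow> qpoch_inf q 5 (Suc b)" for b
    using qpoch_inf_LIMSEQ[OF q, of 5 "Suc b"] by (simp add: f_def)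
  have "(\<lambda>n. (\<Prod>k<n. f (5 * k)) * (\<Prod>k<n. f (5 * k + 1)) * (\<Prod>k<n. f (5 * k + 2)) * (\<Prod>k<n. f (5 * k + 3)) * (\<Prod>k<n. f (5 * k + 4)))
    \<longlonglongrightarrow> qpoch_inf q 5 (Suc 0) * qpoch_inf q 5 (Suc 1) * qpoch_inf q 5 (Suc 2) * qpoch_inf q 5 (Suc 3) * qpoch_inf q 5 (Suc 4)"
    using l[of 0] by (intro tendsto_mult l) simp_all
  moreover have "qpoch_inf q 5 (Suc 0) * qpoch_inf q 5 (Suc 1) * qpoch_inf q 5 (Suc 2) * qpoch_inf q 5 (Suc 3) * qpoch_inf q 5 (Suc 4) = exp (lnA q + lnB q + lnC q)"
    unfolding exp_add exp_lnABC[OF q] by (simp add: eval_nat_numeral)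
  ultimately show "(\<lambda>n. (\<Prod>k<n. f (5 * k)) * (\<Prod>k<n. f (5 * k + 1)) * (\<Prod>k<n. f (5 * k + 2)) * (\<Prod>k<n. f (5 * k + 3)) * (\<Prod>k<n. f (5 * k + 4))) \<longlonglongrightarrow> exp (lnA q + lnB q + lnC q)"
    by simp
qed

text \<open>At tau = i t / 2 the eta nome exp (2 pi i tau) is q itself, so eta is q^(1/24) (q; q),
  which is real.\<close>

lemma dedekind_eta_imaginary:
  assumes t: "0 < t"
  defines "q \<equiv> exp (- pi * t)"
  shows "Re (dedekind_eta (\<i> * complex_of_real t / 2) ^ 4) = exp (ln q / 6 + 4 * (lnA q + lnB q + lnC q))"
proof -
  have q: "0 < q" "q < 1" using t by (auto simp: q_def)
  have e1: "exp (complex_of_real pi * \<i> * (\<i> * complex_of_real t / 2) / 12) = complex_of_real (exp (ln q / 24))"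
  proof -
    have "complex_of_real pi * \<i> * (\<i> * complex_of_real t / 2) / 12 = complex_of_real (ln q / 24)"
      by (simp add: q_def field_simps)
    then show ?thesis by (simp only: exp_of_real)
  qed
  have e2: "1 - exp (complex_of_real (2 * pi) * \<i> * of_nat (Suc n) * (\<i> * complex_of_real t / 2)) = complex_of_real (1 - q ^ Suc n)" for n
  proof -
    have "complex_of_real (2 * pi) * \<i> * of_nat (Suc n) * (\<i> * complex_of_real t / 2) = complex_of_real (real (Suc n) * (- pi * t))"
      by (simp add: field_simps del: of_nat_Suc)
    then show ?thesis by (simp only: exp_of_real exp_of_nat_mult q_def of_real_diff of_real_1)
  qed
  have "(\<lambda>n. 1 - q ^ Suc n) has_prod qpoch_inf q 1 1"
    using qpoch_inf_has_prod[OF q, of 1 1] by simp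
  then have "(\<lambda>n. complex_of_real (1 - q ^ Suc n)) has_prod complex_of_real (qpoch_inf q 1 1)"
    by (simp only: has_prod_of_real_iff)
  then have "dedekind_eta (\<i> * complex_of_real t / 2) = complex_of_real (exp (ln q / 24) * qpoch_inf q 1 1)"
    unfolding dedekind_eta_def e1 e2 by (simp only: has_prod_unique[symmetric] of_real_mult)
  then have "Re (dedekind_eta (\<i> * complex_of_real t / 2) ^ 4) = (exp (ln q / 24) * qpoch_inf q 1 1) ^ 4"
    by (simp only: of_real_power[symmetric] Re_complex_of_real)
  also have "\<dots> = exp (4 * (ln q / 24 + (lnA q + lnB q + lnC q)))"
    unfolding qpoch_inf_1_1[OF q] mult_exp_exp by (simp flip: exp_of_nat_mult)
  finally show ?thesis by (simp add: algebra_simps)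
qed

subsection \<open>Change of variables\<close>

lemma integral_tendsto_improper:
  fixes f :: "real \<Rightarrow> real"
  assumes "f integrable_on {a..}"
  shows "((\<lambda>T. integral {a..T} f) \<longlongrightarrow> integral {a..} f) at_top"
proof (rule tendstoI)
  fix e :: real assume e: "0 < e"
  define I where "I = integral {a..} f"
  have ne: "\<nexists>u v. {a..} = cbox u (v::real)"
  proof
    assume "\<exists>u v. {a..} = cbox u (v::real)"
    then have "bounded {a..}" by (metis bounded_cbox)
    then obtain b where "\<forall>x\<in>{a..}. \<bar>x\<bar> \<le> b" by (auto simp: bounded_iff)
    then have "\<bar>max a (\<bar>b\<bar> + 1)\<bar> \<le> b" by (rule bspec) simp
    then show False by linarith
  qed
  have "(f has_integral I) {a..}" unfolding I_def by (rule integrable_integral[OF assms])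
  then obtain B where B: "B > 0" "\<And>u v. ball 0 B \<subseteq> cbox u v \<Longrightarrow>
      \<exists>z. ((\<lambda>x. if x \<in> {a..} then f x else 0) has_integral z) (cbox u v) \<and> norm (z - I) < e"
    using e ne by (subst (asm) has_integral_alt) auto
  have "dist (integral {a..T} f) I < e" if T: "T \<ge> B + \<bar>a\<bar>" for T
  proof -
    have "ball 0 B \<subseteq> cbox (- T) T" using T by (auto simp: dist_real_def)
    then obtain z where z: "((\<lambda>x. if x \<in> {a..} then f x else 0) has_integral z) (cbox (- T) T)" "norm (z - I) < e"
      using B(2) by blast
    have "((\<lambda>x. if x \<in> {a..T} then f x else 0) has_integral z) (cbox (- T) T)"
      using z(1) by (rule has_integral_eq[rotated]) auto
    moreover have "{a..T} \<subseteq> cbox (- T) T" using T B(1) by auto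
    ultimately have "(f has_integral z) {a..T}" by (simp only: has_integral_restrict)
    then show ?thesis using z(2) by (simp add: integral_unique dist_norm)
  qed
  then show "\<forall>\<^sub>F T in at_top. dist (integral {a..T} f) (integral {a..} f) < e"
    unfolding I_def[symmetric] by (intro eventually_at_top_linorderI)
qed

text \<open>The indefinite gauge integral is continuous up to the endpoint even where the integrand
  is singular, again without absolute convergence.\<close>

lemma integral_tendsto_lower_endpoint:
  fixes f :: "real \<Rightarrow> real"
  assumes f: "f integrable_on {a..b}" and ab: "a < b" and x: "filterlim x (at_right a) F"
  shows "((\<lambda>t. integral {x t..b} f) \<longlongrightarrow> integral {a..b} f) F"
proof -
  have "continuous_on {a..b} (\<lambda>x. integral {x..b} f)"
    by (rule indefinite_integral_continuous_1'[OF f])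
  then have "((\<lambda>x. integral {x..b} f) \<longlongrightarrow> integral {a..b} f) (at a within {a..b})"
    using ab by (simp add: continuous_on_def)
  then have "((\<lambda>x. integral {x..b} f) \<longlongrightarrow> integral {a..b} f) (at_right a)"
    using ab by (simp add: at_within_Icc_at_right)
  then show ?thesis by (rule filterlim_compose[OF _ x])
qed

definition rho :: "real \<Rightarrow> real" where "rho t = RR (exp (- pi * t))"

lemma exp_nome: "0 < t \<Longrightarrow> 0 < exp (- pi * t) \<and> exp (- pi * t) < 1"
  by simp

lemma root_6_exp: "root 6 (exp x) = exp (x / 6)"
  by (rule real_root_pos_unique) (simp_all flip: exp_of_nat_mult)

lemma rho_bounds: "0 < t \<Longrightarrow> 0 < rho t" "0 < t \<Longrightarrow> rho t < x0"
  by (simp_all add: rho_def RR_pos RR_less_x0)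

text \<open>The derivative -pi q of the nome cancels the denominator q in \<open>DERIV_RR\<close>.
  Read as a separable equation, this says that 5 dx / (x h^(1/6)) equals -pi eta^4 dt along x =
  \<open>rho t\<close>.\<close>

lemma DERIV_rho:
  assumes t: "0 < t"
  shows "(rho has_real_derivative
    - (pi / 5 * Re (dedekind_eta (\<i> * complex_of_real t / 2) ^ 4) * (rho t * root 6 (1 / rho t ^ 5 - 11 - rho t ^ 5)))) (at t)"
proof -
  define q where "q = exp (- pi * t)"
  have q: "0 < q" "q < 1" using exp_nome[OF t] by (auto simp: q_def)
  have 1: "((\<lambda>t. exp (- pi * t)) has_real_derivative (- pi * q)) (at t)"
    unfolding q_def by (auto intro!: derivative_eq_intros)
  have rq: "rho t = RR q" by (simp add: rho_def q_def)
  have "(rho has_real_derivative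
      RR q / 5 * (exp (ln q / 6 + 4 * (lnA q + lnB q + lnC q)) * exp (lnh q / 6)) / q * (- pi * q)) (at t)"
    using DERIV_chain2[OF DERIV_RR[OF q, unfolded q_def] 1] unfolding rho_def[abs_def] q_def .
  moreover have "RR q / 5 * (exp (ln q / 6 + 4 * (lnA q + lnB q + lnC q)) * exp (lnh q / 6)) / q * (- pi * q) =
      - (pi / 5 * Re (dedekind_eta (\<i> * complex_of_real t / 2) ^ 4) * (rho t * root 6 (1 / rho t ^ 5 - 11 - rho t ^ 5)))"
    unfolding dedekind_eta_imaginary[OF t] q_def[symmetric] rq RR_identity[OF q] root_6_exp
    using q by (simp add: mult_ac)
  ultimately show ?thesis by (simp only:)
qed

lemma Re_eta_pos: "0 < t \<Longrightarrow> 0 < Re (dedekind_eta (\<i> * complex_of_real t / 2) ^ 4)"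
  by (simp only: dedekind_eta_imaginary exp_gt_zero)

lemma rho_antimono:
  assumes "0 < s" "s \<le> t"
  shows "rho t \<le> rho s"
proof (rule DERIV_nonpos_imp_nonincreasing[OF assms(2)])
  fix u assume "s \<le> u" "u \<le> t"
  then have u: "0 < u" using assms by linarith
  have "0 < 1 / rho u ^ 5 - 11 - rho u ^ 5" using icosahedral_pos rho_bounds[OF u] by simp
  then have "0 \<le> pi / 5 * Re (dedekind_eta (\<i> * complex_of_real u / 2) ^ 4) * (rho u * root 6 (1 / rho u ^ 5 - 11 - rho u ^ 5))"
    using Re_eta_pos[OF u] rho_bounds[OF u] by (intro mult_nonneg_nonneg) (auto simp: less_imp_le)
  then show "\<exists>y. (rho has_real_derivative y) (at u) \<and> y \<le> 0" using DERIV_rho[OF u] by (meson neg_le_0_iff_le)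
qed

lemma rho_at_top: "filterlim rho (at_right 0) at_top"
proof -
  have "filterlim (\<lambda>t. - pi * t) at_bot at_top"
    by (rule filterlim_tendsto_neg_mult_at_bot[OF tendsto_const _ filterlim_ident]) simp
  from filterlim_compose[OF exp_at_bot this]
  have "filterlim (\<lambda>t. exp (- pi * t)) (at_right 0) at_top"
    unfolding filterlim_at by simp
  moreover have "filterlim RR (at_right 0) (at_right 0)"
    unfolding filterlim_at using RR_tendsto_0 eventually_at_right_unit
    by (auto elim!: eventually_mono dest: RR_pos)
  ultimately show ?thesis unfolding rho_def[abs_def] by (rule filterlim_compose[rotated])
qed

lemma substitution_compact:
  assumes G: "continuous_on {0<..<x0} G" and t: "0 < t0" "t0 \<le> T"
  shows "pi * integral {t0..T} (\<lambda>t. Re (dedekind_eta (\<i> * complex_of_real t / 2) ^ 4) * G (rho t)) =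
    5 * integral {rho T..rho t0} (\<lambda>x. G x / (x * root 6 (1 / x ^ 5 - 11 - x ^ 5)))"
proof -
  define f where "f x = G x / (x * root 6 (1 / x ^ 5 - 11 - x ^ 5))" for x
  define c y where "c = rho T" and "y = rho t0"
  define F where "F x = integral {c..x} f" for x
  have c: "0 < c" "c \<le> y" "y < x0"
    using rho_bounds t rho_antimono[OF t] by (auto simp: c_def y_def)
  have cont: "continuous_on {c..y} f"
    unfolding f_def
  proof (intro continuous_intros ballI)
    show "continuous_on {c..y} G" by (rule continuous_on_subset[OF G]) (use c in auto)
    fix x assume "x \<in> {c..y}"
    then have x: "0 < x" "x < x0" using c by auto
    show "x ^ 5 \<noteq> 0" using x by simp
    show "x * root 6 (1 / x ^ 5 - 11 - x ^ 5) \<noteq> 0" using x icosahedral_pos[OF x] by simp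
  qed
  have "((\<lambda>t. - (pi / 5) * (Re (dedekind_eta (\<i> * complex_of_real t / 2) ^ 4) * G (rho t))) has_integral (F (rho T) - F (rho t0))) {t0..T}"
  proof (rule fundamental_theorem_of_calculus[OF t(2)])
    fix u assume u: "u \<in> {t0..T}"
    then have u0: "0 < u" using t by auto
    \<comment> \<open>\<open>F\<close> is differentiated only within \<open>{c..y}\<close>, so the
      chain rule has to run along the image of \<open>rho\<close>.\<close>
    have im: "rho ` {t0..T} \<subseteq> {c..y}"
      using t by (auto simp: c_def y_def intro!: rho_antimono)
    then have "rho u \<in> {c..y}" using u by blast
    then have "(F has_real_derivative f (rho u)) (at (rho u) within {c..y})"
      unfolding F_def by (rule integral_has_real_derivative[OF cont])
    from DERIV_image_chain[OF DERIV_subset[OF this im] has_field_derivative_at_within[OF DERIV_rho[OF u0]]]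
    have "((\<lambda>t. F (rho t)) has_real_derivative f (rho u) *
      - (pi / 5 * Re (dedekind_eta (\<i> * complex_of_real u / 2) ^ 4) * (rho u * root 6 (1 / rho u ^ 5 - 11 - rho u ^ 5)))) (at u within {t0..T})"
      by (simp add: o_def)
    moreover have "f (rho u) * - (pi / 5 * Re (dedekind_eta (\<i> * complex_of_real u / 2) ^ 4) * (rho u * root 6 (1 / rho u ^ 5 - 11 - rho u ^ 5))) =
      - (pi / 5) * (Re (dedekind_eta (\<i> * complex_of_real u / 2) ^ 4) * G (rho u))"
    proof -
      define d where "d = rho u * root 6 (1 / rho u ^ 5 - 11 - rho u ^ 5)"
      have "d \<noteq> 0" using rho_bounds[OF u0] icosahedral_pos[OF rho_bounds[OF u0]] by (simp add: d_def)
      then show ?thesis unfolding f_def d_def[symmetric] by simp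
    qed
    ultimately show "((\<lambda>t. F (rho t)) has_vector_derivative - (pi / 5) * (Re (dedekind_eta (\<i> * complex_of_real u / 2) ^ 4) * G (rho u))) (at u within {t0..T})"
      by (simp only: has_real_derivative_iff_has_vector_derivative)
  qed
  from integral_unique[OF this] have "- (pi / 5) * integral {t0..T} (\<lambda>t. Re (dedekind_eta (\<i> * complex_of_real t / 2) ^ 4) * G (rho t)) =
    F (rho T) - F (rho t0)"
    unfolding integral_mult_right .
  moreover have "F (rho T) = 0" by (simp add: F_def c_def)
  ultimately have "pi * integral {t0..T} (\<lambda>t. Re (dedekind_eta (\<i> * complex_of_real t / 2) ^ 4) * G (rho t)) = 5 * F (rho t0)"
    by linarith
  then show ?thesis by (simp only: F_def c_def f_def[abs_def])
qed

theorem theorem1: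
  fixes G :: "real \<Rightarrow> real" and y A :: real
  assumes smooth: "smooth_on_real {0<..<x0} G"
    and inj: "inj_on (mG_inv G) {0<..}"
    and int_m: "\<forall>r>0. (\<lambda>t. Re (dedekind_eta (\<i> * complex_of_real t / 2) ^ 4) * G (RR (exp (- pi * t))))
                      integrable_on {sqrt r..}"
    and y: "y \<in> {0<..<x0}"
    and int_y: "(\<lambda>t. G t / (t * root 6 (1 / t ^ 5 - 11 - t ^ 5))) integrable_on {0..y}"
    and A: "5 * integral {0..y} (\<lambda>t. G t / (t * root 6 (1 / t ^ 5 - 11 - t ^ 5))) = A"
  shows "y = RR (exp (- pi * sqrt (mG G A)))"
proof -
  define f where "f x = G x / (x * root 6 (1 / x ^ 5 - 11 - x ^ 5))" for x
  define g where "g t = Re (dedekind_eta (\<i> * complex_of_real t / 2) ^ 4) * G (rho t)" for t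
  have "G differentiable (at x)" if "x \<in> {0<..<x0}" for x
    using smooth that unfolding smooth_on_real_def by (metis funpow_0)
  then have G: "continuous_on {0<..<x0} G"
    by (intro continuous_at_imp_continuous_on ballI differentiable_imp_continuous_within)
  obtain q where q: "0 < q" "q < 1" "RR q = y" using RR_surj y by auto
  \<comment> \<open>Chosen with exp (- pi * t0) = q. As \<open>mG_inv\<close> integrates from a
    square root, its matching argument is the square of \<open>t0\<close>.\<close>
  define t0 where "t0 = - ln q / pi"
  have t0: "0 < t0" using q by (simp add: t0_def divide_neg_pos ln_less_zero)
  have rho_t0: "rho t0 = y" using q by (simp add: rho_def t0_def)
  have g_int: "g integrable_on {t0..}"
    using int_m[rule_format, of "t0\<^sup>2"] t0 by (simp add: g_def[abs_def] rho_def)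
  have l1: "((\<lambda>T. pi * integral {t0..T} g) \<longlongrightarrow> pi * integral {t0..} g) at_top"
    by (intro tendsto_intros integral_tendsto_improper g_int)
  have l2: "((\<lambda>T. 5 * integral {rho T..y} f) \<longlongrightarrow> 5 * integral {0..y} f) at_top"
    by (intro tendsto_intros integral_tendsto_lower_endpoint rho_at_top) (use int_y y in \<open>auto simp: f_def[abs_def]\<close>)
  have ev: "\<forall>\<^sub>F T in at_top. 5 * integral {rho T..y} f = pi * integral {t0..T} g"
    using eventually_ge_at_top[of t0]
    by eventually_elim (use substitution_compact[OF G t0] in \<open>simp add: f_def[abs_def] g_def[abs_def] rho_t0\<close>)
  have "pi * integral {t0..} g = 5 * integral {0..y} f"
    by (rule tendsto_unique[OF trivial_limit_at_top_linorder l1 Lim_transform_eventually[OF l2 ev]])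
  then have "mG_inv G (t0\<^sup>2) = A"
    using A t0 by (simp add: mG_inv_def g_def[abs_def] f_def[abs_def] rho_def)
  \<comment> \<open>Injectivity makes the preimage of A selected by \<open>inv_into\<close> equal to
    the square of \<open>t0\<close>.\<close>
  then have "mG G A = t0\<^sup>2"
    unfolding mG_def using inv_into_f_f[OF inj, of "t0\<^sup>2"] t0 by simp
  then show ?thesis using rho_t0 t0 by (simp add: rho_def)
qed

end
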